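(* For every $n\in\mathbb{N}\cup\{\aleph_0,|\mathbb{R}|\}$ there is an acyclic Borel graph $G$ on a standard Borel space with $\o_B(G)=n$. Moreover, if $n\le\aleph_0$, $G$ can be taken to be locally countable.
   Context: An orientation of a graph $G$ on $X$ is a relation $o\subseteq X^2$ such that $\{x,y\}\in G$ iff $(x,y)\in o$ or $(y,x)\in o$; $\operatorname{out}_o(x)=|\{y:(x,y)\in o\}|$. $\o_B(G)=\min\{\sup_x\operatorname{out}_o(x): o\text{ a Borel orientation of } G\}$. *)

theory Defs
  imports "HOL-Analysis.Analysis"
begin

unbundle cardinal_syntax

text \<open>Only the carrier and the \<open>\<sigma>\<close>-algebra of the measure \<open>M\<close> are used here.\<close>

definition standard_borel :: "'a measure \<Rightarrow> bool" where
  "standard_borel M \<longleftrightarrow>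
     (\<exists>T. completely_metrizable_space T \<and> separable_space T \<and> topspace T = space M \<and>
          sets M = sigma_sets (topspace T) {U. openin T U})"

text \<open>A graph is its set of edges, and an edge is an unordered pair \<open>{x, y}\<close> with \<open>x \<noteq> y\<close>.\<close>

definition borel_graph :: "'a measure \<Rightarrow> 'a set set \<Rightarrow> bool" where
  "borel_graph M G \<longleftrightarrow>
     G \<subseteq> {e. e \<subseteq> space M \<and> card e = 2} \<and>
     {(x, y). {x, y} \<in> G} \<in> sets (M \<Otimes>\<^sub>M M)"

definition is_cycle :: "'a set set \<Rightarrow> 'a list \<Rightarrow> bool" where
  "is_cycle G xs \<longleftrightarrow>
     length xs \<ge> 3 \<and> distinct xs \<and>
     (\<forall>i. Suc i < length xs \<longrightarrow> {xs ! i, xs ! Suc i} \<in> G) \<and> {last xs, hd xs} \<in> G"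

definition acyclic_graph :: "'a set set \<Rightarrow> bool" where
  "acyclic_graph G \<longleftrightarrow> (\<nexists>xs. is_cycle G xs)"

definition locally_countable :: "'a measure \<Rightarrow> 'a set set \<Rightarrow> bool" where
  "locally_countable M G \<longleftrightarrow> (\<forall>x\<in>space M. countable {y. {x, y} \<in> G})"

text \<open>An edge may be oriented in both directions.\<close>

definition orientation :: "'a set set \<Rightarrow> ('a \<times> 'a) set \<Rightarrow> bool" where
  "orientation G R \<longleftrightarrow> (\<forall>x y. {x, y} \<in> G \<longleftrightarrow> (x, y) \<in> R \<or> (y, x) \<in> R)"

definition borel_orientation :: "'a measure \<Rightarrow> 'a set set \<Rightarrow> ('a \<times> 'a) set \<Rightarrow> bool" where
  "borel_orientation M G R \<longleftrightarrow> R \<in> sets (M \<Otimes>\<^sub>M M) \<and> orientation G R"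

definition out_degree :: "('a \<times> 'a) set \<Rightarrow> 'a \<Rightarrow> 'a rel" where
  "out_degree R x = |{y. (x, y) \<in> R}|"

text \<open>
  Suprema and minima of cardinals are determined only up to \<open>=o\<close>, so the supremum of a
  family, and the number \<open>o\<^sub>B(G)\<close>, are rendered as relations to a cardinal \<open>\<kappa>\<close>.
  Cardinals that are relations on the vertex type suffice, since every out-degree, and hence
  every supremum of out-degrees, is at most the cardinality of that type.
\<close>

definition is_card_sup :: "'a rel \<Rightarrow> 'a rel set \<Rightarrow> bool" where
  "is_card_sup \<kappa> F \<longleftrightarrow>
     Card_order \<kappa> \<and> (\<forall>r\<in>F. r \<le>o \<kappa>) \<and>
     (\<forall>\<mu>::'a rel. Card_order \<mu> \<and> (\<forall>r\<in>F. r \<le>o \<mu>) \<longrightarrow> \<kappa> \<le>o \<mu>)"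

definition is_borel_orientation_number :: "'a measure \<Rightarrow> 'a set set \<Rightarrow> 'a rel \<Rightarrow> bool" where
  "is_borel_orientation_number M G \<kappa> \<longleftrightarrow>
     (\<exists>R. borel_orientation M G R \<and> is_card_sup \<kappa> (out_degree R ` space M)) \<and>
     (\<forall>R \<mu>. borel_orientation M G R \<and> is_card_sup \<mu> (out_degree R ` space M) \<longrightarrow> \<kappa> \<le>o \<mu>)"

end

(* The graph of a free measure-preserving action of the free group with generators indexed by I has
   Borel orientation number |I|. Orienting every edge along its generator gives the upper bound. For
   the lower bound, each generator b satisfies mu{x. (x, bx) in R} + mu{x. (x, b^-1 x) in R} >= 1,
   because mu is invariant; integrating over b with respect to a finite measure nu on I and applying
   Fubini yields a point whose set of outgoing letters has nu-measure at least nu(I). Counting measure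
   settles finite and countable I. For the continuum, I is the Cantor space and nu an image of
   Lebesgue measure, and Borel sets of positive measure have the cardinality of the continuum.
   The action is profinite: each reduced word acts without fixed points on some finite coordinate. *)

theory Submission
  imports Defs "HOL-Probability.Probability" "HOL-Combinatorics.Permutations"
begin

section \<open>Words without fixed points\<close>

text \<open>With continuum many generators, two obstacles arise. One finite factor per word would
  give uncountably many factors, and the edge set, a union over uncountably many letters, might fail
  to be Borel. For the first, each coordinate sees only a finite prefix of a letter, which is a
  point of Cantor space. A word has finitely many letters, long prefixes tell them apart, and words
  over prefixes are countable in number. For the second, extra two-point coordinates display the
  bits of the letter, so that an edge determines its letter by a Borel function. One action then
  serves all cardinals, by restriction to a Borel set \<open>I\<close> of generators. The finite
  action for a single word is the classical argument for residual finiteness of free groups.\<close>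

fun letter_act :: "('a \<Rightarrow> 'b \<Rightarrow> 'b) \<Rightarrow> 'a \<times> bool \<Rightarrow> 'b \<Rightarrow> 'b" where
  "letter_act f (a, True) = f a"
| "letter_act f (a, False) = inv (f a)"

text \<open>The boolean is the sign of the exponent. Nonempty reduced words stand for the nontrivial
  elements of the free group, so freeness of an action means that none of them fixes a
  point.\<close>

definition reduced :: "('a \<times> bool) list \<Rightarrow> bool" where
  "reduced w \<longleftrightarrow>
     (\<forall>i. Suc i < length w \<longrightarrow> fst (w ! i) = fst (w ! Suc i) \<longrightarrow> snd (w ! i) = snd (w ! Suc i))"

text \<open>In a finite set the complements of domain and image have equally many elements, so any
  bijection between them completes \<open>f\<close>.\<close>

lemma permutes_extend_inj_on:
  assumes "finite S" "D \<subseteq> S" "inj_on f D" "f ` D \<subseteq> S"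
  obtains p where "p permutes S" "\<And>x. x \<in> D \<Longrightarrow> p x = f x"
proof -
  have fin: "finite (S - D)" "finite (S - f ` D)" using assms by auto
  have "card (S - D) = card (S - f ` D)"
    using assms by (simp add: card_Diff_subset finite_subset card_image)
  then obtain g where g: "bij_betw g (S - D) (S - f ` D)"
    using fin finite_same_card_bij by blast
  define p where "p x = (if x \<in> S then if x \<in> D then f x else g x else x)" for x
  have "bij_betw p D (f ` D)"
    using assms by (auto simp: bij_betw_def p_def inj_on_def subset_iff)
  moreover have "bij_betw p (S - D) (S - f ` D)"
    using g by (subst bij_betw_cong[of _ p g]) (auto simp: p_def)
  ultimately have "bij_betw p (D \<union> (S - D)) (f ` D \<union> (S - f ` D))"
    by (rule bij_betw_combine) auto
  moreover have "D \<union> (S - D) = S" "f ` D \<union> (S - f ` D) = S"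
    using assms by auto
  ultimately have "p permutes S"
    by (auto intro!: bij_imp_permutes simp: p_def)
  moreover have "p x = f x" if "x \<in> D" for x
    using that assms by (auto simp: p_def)
  ultimately show thesis using that by blast
qed

text \<open>Lay the word out along the path \<open>0, ..., length w\<close>, one letter per step.
  Each step prescribes one value of one generator. Absence of cancellation makes the prescriptions
  for each generator a partial injection, which extends to a permutation.\<close>

lemma reduced_word_moves:
  assumes "reduced w"
  shows "\<exists>\<sigma>. (\<forall>a. \<sigma> a permutes {..length w}) \<and> fold (letter_act \<sigma>) w 0 = length w"
proof -
  \<comment> \<open>\<open>D a\<close> collects the points where the path prescribes
    \<open>\<sigma> a\<close>, and \<open>f a\<close> gives the value: a letter
    \<open>(a, True)\<close> at \<open>i\<close> demands \<open>i\<close> to \<open>Suc i\<close>, a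
    letter \<open>(a, False)\<close> at \<open>i - 1\<close> demands \<open>i\<close> to
    \<open>i - 1\<close>.\<close>
  define D where "D a = {i. i < length w \<and> w ! i = (a, True)} \<union>
      {i. 0 < i \<and> i \<le> length w \<and> w ! (i - 1) = (a, False)}" for a
  define f where "f a i = (if i < length w \<and> w ! i = (a, True) then Suc i else i - 1)" for a i
  have fT: "f a i = Suc i" if "i < length w \<and> w ! i = (a, True)" for a i
    unfolding f_def using that by (rule if_P)
  have fN: "f a i = i - 1" if "\<not> (i < length w \<and> w ! i = (a, True))" for a i
    unfolding f_def using that by (rule if_not_P)
  have red: "\<not> (w ! i = (a, e) \<and> w ! Suc i = (a, \<not> e))" if "Suc i < length w" for i a e
    using assms that unfolding reduced_def by force
  have fF: "f a (Suc j) = j" if "j < length w" "w ! j = (a, False)" for a j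
    using red[of j a False] that by (auto simp: f_def)
  have inj: "inj_on (f a) (D a)" for a
  proof -
    \<comment> \<open>A forward and a backward step of \<open>a\<close> can share a value only when
      they are adjacent letters, and those would cancel.\<close>
    have clash: False if "i < length w" "w ! i = (a, True)" "0 < j" "j \<le> length w"
        "w ! (j - 1) = (a, False)" "Suc i = j - 1" for i j
      using red[of i a True] that by simp
    show ?thesis
    proof (rule inj_onI)
      fix i j assume ij: "i \<in> D a" "j \<in> D a" "f a i = f a j"
      show "i = j"
      proof (cases "i < length w \<and> w ! i = (a, True)"; cases "j < length w \<and> w ! j = (a, True)")
        assume "i < length w \<and> w ! i = (a, True)" "j < length w \<and> w ! j = (a, True)"
        then show ?thesis using ij(3) fT by (metis nat.inject)
      next
        assume *: "i < length w \<and> w ! i = (a, True)" "\<not> (j < length w \<and> w ! j = (a, True))"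
        then have "Suc i = j - 1" using ij(3) fT fN by metis
        moreover have "0 < j" "j \<le> length w" "w ! (j - 1) = (a, False)"
          using ij(2) * by (simp_all add: D_def)
        ultimately show ?thesis using clash * by blast
      next
        assume *: "\<not> (i < length w \<and> w ! i = (a, True))" "j < length w \<and> w ! j = (a, True)"
        then have "Suc j = i - 1" using ij(3) fT fN by metis
        moreover have "0 < i" "i \<le> length w" "w ! (i - 1) = (a, False)"
          using ij(1) * by (simp_all add: D_def)
        ultimately show ?thesis using clash * by blast
      next
        assume *: "\<not> (i < length w \<and> w ! i = (a, True))" "\<not> (j < length w \<and> w ! j = (a, True))"
        then have "i - 1 = j - 1" using ij(3) fN by metis
        moreover have "0 < i" "0 < j" using ij(1,2) * by (simp_all add: D_def)
        ultimately show ?thesis by linarith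
      qed
    qed
  qed
  have "\<exists>p. p permutes {..length w} \<and> (\<forall>i\<in>D a. p i = f a i)" for a
  proof (rule permutes_extend_inj_on[OF _ _ inj])
    show "finite {..length w}" by simp
    show "D a \<subseteq> {..length w}" by (auto simp: D_def)
    show "f a ` D a \<subseteq> {..length w}" by (auto simp: D_def f_def)
  qed blast
  then obtain \<sigma> where \<sigma>: "\<And>a. \<sigma> a permutes {..length w}"
      and \<sigma>f: "\<And>a i. i \<in> D a \<Longrightarrow> \<sigma> a i = f a i"
    by metis
  have step: "letter_act \<sigma> (w ! j) j = Suc j" if "j < length w" for j
  proof (cases "w ! j")
    case (Pair a e)
    show ?thesis
    proof (cases e)
      case True
      then show ?thesis using Pair that \<sigma>f[of j a] by (simp add: D_def f_def)
    next
      case False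
      have "\<sigma> a (Suc j) = j"
        using Pair False that \<sigma>f[of "Suc j" a] fF[of j a] by (simp add: D_def)
      then show ?thesis
        using Pair False \<sigma>[of a] by (simp add: permutes_inv_eq)
    qed
  qed
  have "j \<le> length w \<Longrightarrow> fold (letter_act \<sigma>) (take j w) 0 = j" for j
    by (induction j) (simp_all add: take_Suc_conv_app_nth step)
  from this[of "length w"] \<sigma> show ?thesis by auto
qed

text \<open>Composing with the permutations of the previous lemma on the left turns a word that moves
  one point into a word that moves every point.\<close>

lemma reduced_word_fixed_point_free:
  assumes "reduced w" "w \<noteq> []"
  shows "\<exists>(S :: nat set) \<tau>. finite S \<and> S \<noteq> {} \<and> (\<forall>a. \<tau> a permutes S) \<and>
    (\<forall>s\<in>S. fold (letter_act \<tau>) w s \<noteq> s)"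
proof -
  obtain \<sigma> where \<sigma>: "\<And>a. \<sigma> a permutes {..length w}"
      and mv: "fold (letter_act \<sigma>) w 0 = length w"
    using reduced_word_moves[OF assms(1)] by blast
  \<comment> \<open>The symmetric group, acted on by left multiplication: there a non-identity
    element has no fixed point. The bijection \<open>h\<close> below renumbers it by
    naturals.\<close>
  define Q where "Q = {p. p permutes {..length w}}"
  have "finite Q" unfolding Q_def by (rule finite_permutations) simp
  then obtain h where h: "bij_betw h Q {0..<card Q}"
    using ex_bij_betw_finite_nat by blast
  define S where "S = {0..<card Q}"
  define \<tau> where "\<tau> a s = (if s \<in> S then h (\<sigma> a \<circ> inv_into Q h s) else s)" for a s
  have h': "inv_into Q h (h p) = p" if "p \<in> Q" for p
    using h that by (meson bij_betw_inv_into_left)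
  have hS: "h p \<in> S" if "p \<in> Q" for p
    using h that S_def bij_betwE by blast
  have \<tau>h: "\<tau> a (h p) = h (\<sigma> a \<circ> p)" if "p \<in> Q" for a p
    using that by (simp add: \<tau>_def h' hS)
  have Qc: "\<sigma> a \<circ> p \<in> Q" "inv (\<sigma> a) \<circ> p \<in> Q" if "p \<in> Q" for a p
    using that \<sigma>[of a] by (auto simp: Q_def intro: permutes_compose permutes_inv)
  have perm: "\<tau> a permutes S" for a
  proof -
    have "inj_on (\<tau> a) S"
    proof (rule inj_onI)
      fix s t assume st: "s \<in> S" "t \<in> S" "\<tau> a s = \<tau> a t"
      obtain p q where pq: "p \<in> Q" "q \<in> Q" "s = h p" "t = h q"
        using st(1,2) h unfolding S_def bij_betw_def by blast
      then have "h (\<sigma> a \<circ> p) = h (\<sigma> a \<circ> q)" using st \<tau>h by simp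
      then have "\<sigma> a \<circ> p = \<sigma> a \<circ> q" using pq Qc h' by metis
      then have "p = q"
        using permutes_inj[OF \<sigma>[of a]] by (simp add: fun_eq_iff inj_eq)
      then show "s = t" using pq by simp
    qed
    moreover have "\<tau> a ` S \<subseteq> S"
    proof
      fix t assume "t \<in> \<tau> a ` S"
      then obtain s where "s \<in> S" "t = \<tau> a s" by blast
      moreover obtain p where "p \<in> Q" "s = h p"
        using \<open>s \<in> S\<close> h unfolding S_def bij_betw_def by blast
      ultimately have "p \<in> Q" "t = \<tau> a (h p)" by simp_all
      then show "t \<in> S" using \<tau>h Qc hS by simp
    qed
    ultimately have "bij_betw (\<tau> a) S S"
      by (simp add: S_def bij_betw_def endo_inj_surj)
    then show ?thesis by (auto intro!: bij_imp_permutes simp: \<tau>_def)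
  qed
  have act: "letter_act \<tau> c (h p) = h (letter_act \<sigma> c \<circ> p)" "letter_act \<sigma> c \<circ> p \<in> Q"
    if "p \<in> Q" for c p
  proof -
    obtain a e where c: "c = (a, e)" by (cases c)
    have "inv (\<tau> a) (h p) = h (inv (\<sigma> a) \<circ> p)"
      using that Qc \<tau>h[of "inv (\<sigma> a) \<circ> p" a] permutes_inv_o(1)[OF \<sigma>[of a]]
      by (simp add: permutes_inv_eq[OF perm] o_assoc)
    then show "letter_act \<tau> c (h p) = h (letter_act \<sigma> c \<circ> p)" "letter_act \<sigma> c \<circ> p \<in> Q"
      using that \<tau>h Qc c by (cases e; simp)+
  qed
  have eval: "p \<in> Q \<Longrightarrow> fold (letter_act \<tau>) v (h p) = h (fold (letter_act \<sigma>) v \<circ> p) \<and>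
      fold (letter_act \<sigma>) v \<circ> p \<in> Q" for v p
  proof (induction v arbitrary: p)
    case (Cons c v)
    show ?case
      using Cons.IH[OF act(2)[OF Cons.prems, of c]] act(1)[OF Cons.prems, of c]
      by (simp add: comp_def)
  qed simp
  have "fold (letter_act \<tau>) w s \<noteq> s" if "s \<in> S" for s
  proof
    assume fx: "fold (letter_act \<tau>) w s = s"
    have "s \<in> h ` Q" using that h by (simp add: S_def bij_betw_imp_surj_on)
    then obtain p where p: "p \<in> Q" "s = h p" by blast
    have "fold (letter_act \<sigma>) w \<circ> p = p"
    proof (rule inj_onD[OF bij_betw_imp_inj_on[OF h] _ _ p(1)])
      show "h (fold (letter_act \<sigma>) w \<circ> p) = h p"
        using eval[OF p(1), of w] fx unfolding p(2) by argo
      show "fold (letter_act \<sigma>) w \<circ> p \<in> Q"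
        using eval[OF p(1), of w] by argo
    qed
    \<comment> \<open>At the preimage of \<open>0\<close> under \<open>p\<close> the two sides are
      \<open>length w\<close> and \<open>0\<close>.\<close>
    moreover obtain i where "p i = 0"
      using p(1) permutes_surj[of p] unfolding Q_def by (metis mem_Collect_eq surjD)
    ultimately have "length w = 0"
      using mv by (metis comp_apply)
    then show False using assms(2) by simp
  qed
  moreover have "S \<noteq> {}"
  proof -
    have "id \<in> Q" by (simp add: Q_def permutes_id)
    then show ?thesis using hS by blast
  qed
  ultimately show ?thesis
    using perm by (intro exI[of _ S] exI[of _ \<tau>]) (auto simp: S_def)
qed

section \<open>A measure-preserving free action of a free group on a profinite space\<close>

text \<open>Each of the finitely many pairs of distinct sequences differs at some position;
  \<open>n\<close> exceeds one such position for each pair.\<close>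

lemma finite_separated_by_prefixes:
  assumes "finite (F :: (nat \<Rightarrow> 'a) set)"
  shows "\<exists>n. inj_on (\<lambda>b. map b [0..<n]) F"
proof -
  define j where "j = (\<lambda>(b, b' :: nat \<Rightarrow> 'a). SOME j. b j \<noteq> b' j)"
  have j: "b (j (b, b')) \<noteq> b' (j (b, b'))" if "b \<noteq> b'" for b b'
    using someI_ex[of "\<lambda>j. b j \<noteq> b' j"] that by (auto simp: j_def fun_eq_iff)
  have "finite (j ` (F \<times> F))" using assms by blast
  then obtain n where n: "\<And>i. i \<in> j ` (F \<times> F) \<Longrightarrow> i < n"
    unfolding finite_nat_set_iff_bounded by blast
  have "inj_on (\<lambda>b. map b [0..<n]) F"
  proof (rule inj_onI, rule ccontr)
    fix b b' assume *: "b \<in> F" "b' \<in> F" "map b [0..<n] = map b' [0..<n]" "b \<noteq> b'"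
    then have "j (b, b') < n" using n by blast
    then show False using *(3) j[OF *(4)] by (simp add: map_eq_conv)
  qed
  then show ?thesis ..
qed

text \<open>The letters are the points of Cantor space. The coordinates \<open>d j\<close> make the letter \<open>b\<close>
  readable from \<open>x\<close> and its image, so that the graph of the action is Borel.\<close>

locale profinite_system =
  fixes S :: "'c::countable \<Rightarrow> nat set"
    and \<tau> :: "'c \<Rightarrow> (nat \<Rightarrow> bool) \<Rightarrow> nat \<Rightarrow> nat"
    and d :: "nat \<Rightarrow> 'c"
  assumes finite_S: "finite (S m)"
    and S_nonempty: "S m \<noteq> {}"
    and perm: "\<tau> m b permutes S m"
    and prefix: "\<exists>n \<kappa>. \<forall>b. \<tau> m b = \<kappa> (map b [0..<n])"
    and moves_iff: "s \<in> S (d j) \<Longrightarrow> \<tau> (d j) b s \<noteq> s \<longleftrightarrow> b j"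
    and fixed_point_free:
      "reduced w \<Longrightarrow> w \<noteq> [] \<Longrightarrow> \<exists>m. \<forall>s\<in>S m. fold (letter_act (\<tau> m)) w s \<noteq> s"

text \<open>There is one two-point coordinate per bit of a letter and one coordinate per word over
  prefixes. A reduced word over Cantor space, truncated where its letters are separated, is a
  reduced word over prefixes and moves every point of its own coordinate.\<close>

lemma profinite_system_exists:
  "\<exists>(S :: nat + (bool list \<times> bool) list \<Rightarrow> nat set) \<tau> d. profinite_system S \<tau> d"
proof -
  have "\<forall>w. \<exists>(S :: nat set) \<theta> :: bool list \<Rightarrow> nat \<Rightarrow> nat.
      finite S \<and> S \<noteq> {} \<and> (\<forall>a. \<theta> a permutes S) \<and>
      (reduced w \<and> w \<noteq> [] \<longrightarrow> (\<forall>s\<in>S. fold (letter_act \<theta>) w s \<noteq> s))"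
    (is "\<forall>w. \<exists>S \<theta>. ?P w S \<theta>")
  proof
    fix w :: "(bool list \<times> bool) list"
    show "\<exists>S \<theta>. ?P w S \<theta>"
    proof (cases "reduced w \<and> w \<noteq> []")
      case True
      then obtain S :: "nat set" and \<theta> where "finite S" "S \<noteq> {}" "\<forall>a. \<theta> a permutes S"
          "\<forall>s\<in>S. fold (letter_act \<theta>) w s \<noteq> s"
        using reduced_word_fixed_point_free[of w] by metis
      then have "?P w S \<theta>" by simp
      then show ?thesis by (intro exI)
    next
      \<comment> \<open>Empty or cancelling words get an idle one-point coordinate.\<close>
      case False
      then have "?P w {0} (\<lambda>_. id)" by auto
      then show ?thesis by (intro exI)
    qed
  qed
  from choice[OF this] obtain U where "\<forall>w. \<exists>\<theta>. ?P w (U w) \<theta>" ..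
  from choice[OF this] obtain \<theta> where U: "?P w (U w) (\<theta> w)" for w by blast
  define S where "S = case_sum (\<lambda>_::nat. {0, 1::nat}) U"
  \<comment> \<open>The coordinate of \<open>w\<close> has to know where to truncate. The words that
    matter have prefixes of one common length, so the first letter tells it.\<close>
  define \<tau> where "\<tau> = case_sum (\<lambda>j (b::nat \<Rightarrow> bool). if b j then Transposition.transpose 0 1 else id)
      (\<lambda>w b. \<theta> w (map b [0..<length (fst (hd w))]))"
  have "profinite_system S \<tau> Inl"
  proof
    show "finite (S m)" "S m \<noteq> {}" for m using U by (cases m; simp add: S_def)+
    show "\<tau> m b permutes S m" for m b
      using U by (cases m) (simp_all add: S_def \<tau>_def permutes_swap_id permutes_id)
    show "\<exists>n \<kappa>. \<forall>b. \<tau> m b = \<kappa> (map b [0..<n])" for m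
    proof (cases m)
      case (Inl j)
      show ?thesis
        by (rule exI[of _ "Suc j"], rule exI[of _ "\<lambda>l. if l ! j then Transposition.transpose 0 1 else id"])
          (simp add: Inl \<tau>_def nth_append)
    next
      case (Inr w)
      show ?thesis
        by (rule exI[of _ "length (fst (hd w))"], rule exI[of _ "\<theta> w"]) (simp add: Inr \<tau>_def)
    qed
    show "\<tau> (Inl j) b s \<noteq> s \<longleftrightarrow> b j" if "s \<in> S (Inl j)" for s j b
      using that by (auto simp: S_def \<tau>_def)
    fix w :: "((nat \<Rightarrow> bool) \<times> bool) list"
    assume w: "reduced w" "w \<noteq> []"
    obtain n where n: "inj_on (\<lambda>b. map b [0..<n]) (fst ` set w)"
      using finite_separated_by_prefixes[of "fst ` set w"] by auto
    define r where "r = (\<lambda>b::nat \<Rightarrow> bool. map b [0..<n])"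
    define w' where "w' = map (\<lambda>(b, e). (r b, e)) w"
    have "reduced w'"
      \<comment> \<open>Truncation is injective on the letters of \<open>w\<close>, so adjacent
        letters that agree after truncation agreed before.\<close>
      unfolding reduced_def
    proof (intro allI impI)
      fix i assume i: "Suc i < length w'" "fst (w' ! i) = fst (w' ! Suc i)"
      then have "r (fst (w ! i)) = r (fst (w ! Suc i))"
        by (simp add: w'_def case_prod_beta)
      then have "fst (w ! i) = fst (w ! Suc i)"
        using inj_onD[OF n] i(1) by (simp add: r_def w'_def)
      then show "snd (w' ! i) = snd (w' ! Suc i)"
        using w(1) i(1) unfolding reduced_def by (simp add: w'_def case_prod_beta)
    qed
    moreover have "w' \<noteq> []" using w by (simp add: w'_def)
    ultimately have free: "\<forall>s\<in>U w'. fold (letter_act (\<theta> w')) w' s \<noteq> s" using U by blast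
    have "length (fst (hd w')) = n"
      using w by (cases w) (auto simp: w'_def r_def)
    then have "\<tau> (Inr w') b = \<theta> w' (r b)" for b by (simp add: \<tau>_def r_def)
    then have act: "letter_act (\<tau> (Inr w')) (b, e) = letter_act (\<theta> w') (r b, e)" for b e
      by (cases e) simp_all
    have "fold (letter_act (\<tau> (Inr w'))) v s =
        fold (letter_act (\<theta> w')) (map (\<lambda>(b, e). (r b, e)) v) s" for v s
      by (induction v arbitrary: s) (auto simp: act)
    then show "\<exists>m. \<forall>s\<in>S m. fold (letter_act (\<tau> m)) w s \<noteq> s"
      using free by (intro exI[of _ "Inr w'"]) (simp add: S_def w'_def)
  qed
  then show ?thesis by blast
qed

abbreviation cantor_measure :: "(nat \<Rightarrow> bool) measure" where
  "cantor_measure \<equiv> Pi\<^sub>M UNIV (\<lambda>_. count_space UNIV)"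

section \<open>The coordinatewise action and its invariant measure\<close>

context profinite_system
begin

definition shift :: "(nat \<Rightarrow> bool) \<Rightarrow> ('c \<Rightarrow> nat) \<Rightarrow> 'c \<Rightarrow> nat" where
  "shift b x = (\<lambda>m. \<tau> m b (x m))"

text \<open>The profinite space proper, inside the product of copies of \<open>nat\<close>. It is
  invariant and has full measure; points outside it will be isolated vertices.\<close>

definition Y :: "('c \<Rightarrow> nat) set" where
  "Y = {x. \<forall>m. x m \<in> S m}"

abbreviation X :: "('c \<Rightarrow> nat) measure" where
  "X \<equiv> Pi\<^sub>M UNIV (\<lambda>_. count_space UNIV)"

definition \<mu> :: "('c \<Rightarrow> nat) measure" where
  "\<mu> = Pi\<^sub>M UNIV (\<lambda>m. measure_pmf (pmf_of_set (S m)))"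

lemma inv_shift: "inv (shift b) = (\<lambda>x m. inv (\<tau> m b) (x m))"
  by (rule inv_equality) (auto simp: shift_def permutes_inverses[OF perm])

lemma bij_shift: "bij (shift b)"
  by (rule o_bij[of "\<lambda>x m. inv (\<tau> m b) (x m)"])
    (auto simp: shift_def permutes_inverses[OF perm] fun_eq_iff)

lemma shift_Y [simp]: "shift b x \<in> Y \<longleftrightarrow> x \<in> Y" "inv (shift b) x \<in> Y \<longleftrightarrow> x \<in> Y"
  using permutes_in_image[OF perm] permutes_in_image[OF permutes_inv[OF perm]]
  by (simp_all add: Y_def shift_def inv_shift)

lemma shift_inv [simp]: "shift b (inv (shift b) x) = x" "inv (shift b) (shift b x) = x"
  using bij_shift[of b] by (simp_all add: bij_is_surj surj_f_inv_f bij_is_inj)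

lemma fold_letter_act_shift:
  "fold (letter_act shift) w x = (\<lambda>m. fold (letter_act (\<tau> m)) w (x m))"
proof (induction w arbitrary: x)
  case (Cons c w)
  obtain b e where "c = (b, e)" by (cases c)
  then show ?case using Cons.IH by (cases e) (simp_all add: inv_shift, simp add: shift_def)
qed simp

lemma free_action:
  assumes "reduced w" "w \<noteq> []" "x \<in> Y"
  shows "fold (letter_act shift) w x \<noteq> x"
proof -
  from fixed_point_free[OF assms(1,2)]
  obtain m where "\<forall>s\<in>S m. fold (letter_act (\<tau> m)) w s \<noteq> s" ..
  then have "fold (letter_act (\<tau> m)) w (x m) \<noteq> x m" using assms(3) by (simp add: Y_def)
  then show ?thesis unfolding fold_letter_act_shift by metis
qed

text \<open>Bit \<open>j\<close> of the generator shows as a change of coordinate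
  \<open>d j\<close>. Being symmetric, the formula reads the same letter off an edge in both
  directions.\<close>

definition letter :: "('c \<Rightarrow> nat) \<Rightarrow> ('c \<Rightarrow> nat) \<Rightarrow> nat \<Rightarrow> bool" where
  "letter x y = (\<lambda>j. x (d j) \<noteq> y (d j))"

lemma letter_commute: "letter x y = letter y x"
  by (auto simp: letter_def)

lemma letter_shift [simp]: "x \<in> Y \<Longrightarrow> letter x (shift b x) = b"
proof (rule ext)
  fix j assume "x \<in> Y"
  then show "letter x (shift b x) j = b j"
    using moves_iff[of "x (d j)" j b] by (auto simp: letter_def shift_def Y_def)
qed

lemma letter_inv_shift [simp]: "x \<in> Y \<Longrightarrow> letter x (inv (shift b) x) = b"
  using letter_shift[of "inv (shift b) x" b] by (simp add: letter_commute[of x])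

lemma sets_\<mu>: "sets \<mu> = sets X"
  unfolding \<mu>_def by (rule sets_PiM_cong) simp_all

lemma space_\<mu>: "space \<mu> = UNIV"
  by (simp add: \<mu>_def space_PiM)

sublocale \<mu>: prob_space \<mu>
  unfolding \<mu>_def by (rule prob_space_PiM) (rule measure_pmf.prob_space_axioms)

lemma AE_Y: "AE x in \<mu>. x \<in> Y"
proof -
  have "AE x in \<mu>. x m \<in> S m" for m
    unfolding \<mu>_def
    by (rule AE_PiM_component)
      (auto simp: measure_pmf.prob_space_axioms AE_measure_pmf_iff finite_S S_nonempty)
  then show ?thesis by (simp add: Y_def AE_all_countable)
qed

text \<open>Each coordinate depends on the letter through a finite prefix only, which leaves
  countably many cases. The parameter \<open>\<phi>\<close> covers the action (identity) and its
  inverse (\<open>inv\<close>) at once.\<close>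

lemma measurable_coordinatewise:
  "(\<lambda>p m. \<phi> (\<tau> m (fst p)) (snd p m)) \<in> measurable (cantor_measure \<Otimes>\<^sub>M X) X"
proof (rule measurable_PiM_single'[where f = "\<lambda>m p. \<phi> (\<tau> m (fst p)) (snd p m)"])
  fix m
  obtain n \<kappa> where \<kappa>: "\<And>b. \<tau> m b = \<kappa> (map b [0..<n])" using prefix by blast
  have pre: "(\<lambda>b. map b [0..<k]) \<in> measurable cantor_measure (count_space UNIV)" for k
  proof (induction k)
    case (Suc k)
    have "(\<lambda>b. (\<lambda>l b. l @ [b k]) (map b [0..<k]) b) \<in> measurable cantor_measure (count_space UNIV)"
    proof (rule measurable_compose_countable[OF _ Suc])
      fix l :: "bool list"
      show "(\<lambda>b. l @ [b k]) \<in> measurable cantor_measure (count_space UNIV)"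
        by (rule measurable_compose[OF measurable_component_singleton]) simp_all
    qed
    then show ?case by simp
  qed simp
  have "(\<lambda>p. (\<lambda>l p. \<phi> (\<kappa> l) (snd p m)) (map (fst p) [0..<n]) p)
      \<in> measurable (cantor_measure \<Otimes>\<^sub>M X) (count_space UNIV)"
  proof (rule measurable_compose_countable[where f = "\<lambda>l p. \<phi> (\<kappa> l) (snd p m)"])
    show "(\<lambda>p. map (fst p) [0..<n]) \<in> measurable (cantor_measure \<Otimes>\<^sub>M X) (count_space UNIV)"
      by (rule measurable_compose[OF measurable_fst pre])
    fix l
    have "(\<lambda>p. snd p m) \<in> measurable (cantor_measure \<Otimes>\<^sub>M X) (count_space UNIV)"
      by (rule measurable_compose[OF measurable_snd measurable_component_singleton]) simp
    then show "(\<lambda>p. \<phi> (\<kappa> l) (snd p m)) \<in> measurable (cantor_measure \<Otimes>\<^sub>M X) (count_space UNIV)"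
      by (rule measurable_compose) simp
  qed
  then show "(\<lambda>p. \<phi> (\<tau> m (fst p)) (snd p m))
      \<in> measurable (cantor_measure \<Otimes>\<^sub>M X) (count_space UNIV)"
    by (simp add: \<kappa>)
qed (simp add: space_PiM)

lemma measurable_shift_pair:
  assumes "f \<in> measurable N cantor_measure" "g \<in> measurable N X"
  shows "(\<lambda>p. shift (f p) (g p)) \<in> measurable N X"
    and "(\<lambda>p. inv (shift (f p)) (g p)) \<in> measurable N X"
proof -
  have *: "(\<lambda>p m. \<phi> (\<tau> m (f p)) (g p m)) \<in> measurable N X" for \<phi> :: "(nat \<Rightarrow> nat) \<Rightarrow> nat \<Rightarrow> nat"
    using measurable_compose[OF measurable_Pair[OF assms] measurable_coordinatewise[of \<phi>]] by simp
  show "(\<lambda>p. shift (f p) (g p)) \<in> measurable N X"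
    using *[of "\<lambda>f. f"] unfolding shift_def .
  show "(\<lambda>p. inv (shift (f p)) (g p)) \<in> measurable N X"
    using *[of inv] unfolding inv_shift .
qed

lemma measurable_shift: "shift b \<in> measurable X X"
  by (rule measurable_shift_pair(1)) (simp_all add: space_PiM)

text \<open>A permutation of \<open>S m\<close> preserves the uniform measure on it, preimages of
  cylinders are cylinders, and cylinders determine the product measure.\<close>

lemma distr_shift: "distr \<mu> \<mu> (shift b) = \<mu>"
proof -
  define p where "p m = measure_pmf (pmf_of_set (S m))" for m
  interpret product_prob_space p UNIV
    by (rule product_prob_spaceI) (simp add: p_def measure_pmf.prob_space_axioms)
  have meas: "shift b \<in> measurable \<mu> \<mu>"
    using measurable_shift measurable_cong_sets[OF sets_\<mu> sets_\<mu>] by blast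
  have \<mu>: "\<mu> = Pi\<^sub>M UNIV p" by (simp add: \<mu>_def p_def[abs_def])
  have p_inv: "emeasure (p m) (\<tau> m b -` A) = emeasure (p m) A" for m A
  proof -
    have "map_pmf (\<tau> m b) (pmf_of_set (S m)) = pmf_of_set (\<tau> m b ` S m)"
      using perm[of m b] finite_S S_nonempty
      by (intro map_pmf_of_set_inj) (auto intro: permutes_inj_on)
    then have "map_pmf (\<tau> m b) (pmf_of_set (S m)) = pmf_of_set (S m)"
      using permutes_image[OF perm] by simp
    then show ?thesis
      unfolding p_def by (metis emeasure_map_pmf)
  qed
  have "distr \<mu> \<mu> (shift b) = Pi\<^sub>M UNIV p"
  proof (rule PiM_eq)
    show "sets (distr \<mu> \<mu> (shift b)) = sets (Pi\<^sub>M UNIV p)" by (simp add: \<mu>)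
    fix J and F :: "'c \<Rightarrow> nat set"
    assume J: "finite J" "J \<subseteq> UNIV" and F: "\<And>j. j \<in> J \<Longrightarrow> F j \<in> sets (p j)"
    have "emeasure (distr \<mu> \<mu> (shift b)) (prod_emb UNIV p J (Pi\<^sub>E J F)) =
        emeasure \<mu> (shift b -` prod_emb UNIV p J (Pi\<^sub>E J F) \<inter> space \<mu>)"
      using J F by (intro emeasure_distr[OF meas]) (auto simp: \<mu>)
    also have "shift b -` prod_emb UNIV p J (Pi\<^sub>E J F) \<inter> space \<mu> =
        prod_emb UNIV p J (\<Pi>\<^sub>E j\<in>J. \<tau> j b -` F j)"
      by (auto simp: prod_emb_def space_\<mu> shift_def p_def PiE_iff restrict_def extensional_def)
    also have "emeasure \<mu> \<dots> = (\<Prod>j\<in>J. emeasure (p j) (\<tau> j b -` F j))"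
      unfolding \<mu> using J by (intro emeasure_PiM_emb) (auto simp: p_def)
    finally show "emeasure (distr \<mu> \<mu> (shift b)) (prod_emb UNIV p J (Pi\<^sub>E J F)) =
        (\<Prod>j\<in>J. emeasure (p j) (F j))"
      by (simp add: p_inv)
  qed
  then show ?thesis by (simp add: \<mu>)
qed

end

section \<open>Borel sets of positive Lebesgue measure have the cardinality of the continuum\<close>

text \<open>The distribution function \<open>f\<close> of Lebesgue measure on a closed subset \<open>K\<close> maps \<open>K\<close> onto
  all intermediate values, because \<open>f\<close> is constant on every interval missing \<open>K\<close>.\<close>

lemma positive_measure_imp_continuum:
  fixes A :: "real set"
  assumes "A \<in> sets borel" "A \<subseteq> {0..1}" "emeasure lborel A \<noteq> 0"
  shows "(UNIV :: real set) \<lesssim> A"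
proof -
  have fm: "B \<in> fmeasurable lborel" if "B \<in> sets borel" "B \<subseteq> {0..1}" for B :: "real set"
  proof (rule fmeasurableI2)
    show "{0..1::real} \<in> fmeasurable lborel" by (simp add: fmeasurable_def)
  qed (use that in auto)
  define a where "a = measure lborel A"
  have emA: "emeasure lborel A = ennreal a"
    using fm[OF assms(1,2)] by (simp add: a_def emeasure_eq_measure2)
  then have "a > 0" using assms(3) by (auto simp: a_def zero_less_measure_iff measure_nonneg)
  have "A \<in> sets lebesgue" using assms(1) by simp
  \<comment> \<open>Inner regularity with loss below \<open>a\<close>, so that \<open>K\<close>
    keeps positive measure.\<close>
  then obtain K where K: "closed K" "K \<subseteq> A" "emeasure lebesgue (A - K) < ennreal a"
    using sets_lebesgue_inner_closed[OF _ \<open>a > 0\<close>] by metis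
  have Kb: "K \<in> sets borel" "K \<subseteq> {0..1}" using K assms by auto
  have lK: "emeasure lborel (A - K) < ennreal a"
    using K(3) assms(1) Kb(1) by simp
  define f where "f t = measure lborel (K \<inter> {..t})" for t
  have fmK: "K \<inter> B \<in> fmeasurable lborel" if "B \<in> sets borel" for B
    using Kb that by (intro fm) auto
  have diff: "f t - f s = measure lborel (K \<inter> {s<..t})" if "s \<le> t" for s t
  proof -
    have "measure lborel ((K \<inter> {..s}) \<union> (K \<inter> {s<..t})) = f s + measure lborel (K \<inter> {s<..t})"
      unfolding f_def by (intro measure_Un_AE) (auto intro: fmK)
    moreover have "(K \<inter> {..s}) \<union> (K \<inter> {s<..t}) = K \<inter> {..t}" using that by auto
    ultimately show ?thesis by (simp add: f_def)
  qed
  have mono: "f s \<le> f t" if "s \<le> t" for s t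
    using diff[OF that] measure_nonneg[of lborel "K \<inter> {s<..t}"] by linarith
  \<comment> \<open>This bound serves as continuity of \<open>f\<close>: it excludes a jump at
    \<open>t0\<close> below.\<close>
  have lip: "f t - f s \<le> t - s" if "s \<le> t" for s t
  proof -
    have "measure lborel (K \<inter> {s<..t}) \<le> measure lborel {s<..t}"
      using Kb(1) that by (intro measure_mono_fmeasurable) (auto simp: fmeasurable_def)
    then show ?thesis using diff[OF that] that by simp
  qed
  have f0: "f t \<le> 0" if "t \<le> 0" for t
  proof -
    have "measure lborel (K \<inter> {..t}) \<le> measure lborel {0::real}"
    proof (rule measure_mono_fmeasurable)
      show "K \<inter> {..t} \<subseteq> {0}" using Kb(2) that by force
    qed (use Kb(1) in \<open>auto simp: fmeasurable_def\<close>)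
    then show ?thesis by (simp add: f_def)
  qed
  have "f 1 > 0"
  proof (rule ccontr)
    assume "\<not> f 1 > 0"
    moreover have "K \<inter> {..1} = K" using Kb by auto
    ultimately have "measure lborel K = 0"
      using measure_nonneg[of lborel K] by (simp add: f_def)
    then have "emeasure lborel K = 0"
      using fmK[of UNIV] by (simp add: emeasure_eq_measure2)
    then have "emeasure lborel A \<le> emeasure lborel (A - K) + 0"
      using emeasure_subadditive[of "A - K" lborel K] Kb assms(1) K(2)
      by (simp add: Un_absorb2)
    then show False using lK emA by simp
  qed
  have "{0<..<f 1} \<subseteq> f ` K"
  proof
    fix v assume v: "v \<in> {0<..<f 1}"
    \<comment> \<open>\<open>t0 = Inf W\<close> is the first time \<open>f\<close> reaches
      \<open>v\<close>. If \<open>t0\<close> were outside the closed set \<open>K\<close>, then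
      \<open>f\<close> would already equal \<open>f t0\<close> slightly earlier.\<close>
    define W where "W = {t. v \<le> f t}"
    have W0: "0 < t" if "t \<in> W" for t using that v f0[of t] by (force simp: W_def)
    have bdd: "bdd_below W" using W0 by (force intro: bdd_belowI[of _ 0])
    have ne: "1 \<in> W" using v by (simp add: W_def)
    define t0 where "t0 = Inf W"
    have below: "f t < v" if "t < t0" for t
      using that cInf_lower[OF _ bdd, of t] by (force simp: W_def t0_def)
    have above: "v \<le> f t" if t: "t0 < t" for t
    proof -
      obtain s where "s \<in> W" "s < t"
        using cInf_lessD[of W t] t ne unfolding t0_def by blast
      then show ?thesis using mono[of s t] by (simp add: W_def)
    qed
    have "f t0 \<ge> v"
    proof (rule ccontr)
      assume "\<not> f t0 \<ge> v"
      then have "v - f t0 > 0" by simp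
      then show False
        using lip[of t0 "t0 + (v - f t0) / 2"] above[of "t0 + (v - f t0) / 2"] by (simp add: field_simps)
    qed
    moreover have "f t0 \<le> v"
    proof (rule ccontr)
      assume "\<not> f t0 \<le> v"
      then have "f t0 - v > 0" by simp
      then show False
        using lip[of "t0 - (f t0 - v) / 2" t0] below[of "t0 - (f t0 - v) / 2"] by (simp add: field_simps)
    qed
    moreover have "t0 \<in> K"
    proof (rule ccontr)
      assume "t0 \<notin> K"
      then obtain e where e: "e > 0" "ball t0 e \<subseteq> - K"
        using K(1) by (metis ComplI open_Compl open_contains_ball)
      have "K \<inter> {t0 - e / 2<..t0} = {}"
      proof -
        have "{t0 - e / 2<..t0} \<subseteq> ball t0 e" using e(1) by (auto simp: dist_real_def)
        then show ?thesis using e(2) by blast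
      qed
      then have "f (t0 - e / 2) = f t0"
        using diff[of "t0 - e / 2" t0] e(1) by simp
      then show False using below[of "t0 - e / 2"] \<open>f t0 \<ge> v\<close> e(1) by simp
    qed
    ultimately show "v \<in> f ` K" by force
  qed
  then have "{0<..<f 1} \<lesssim> K"
    by (meson image_lepoll lepoll_trans subset_imp_lepoll)
  moreover have "(UNIV :: real set) \<lesssim> {0<..<f 1}"
    using open_interval_eqpoll_reals[of 0 "f 1"] \<open>f 1 > 0\<close> eqpoll_imp_lepoll eqpoll_sym by blast
  ultimately show ?thesis
    using K(2) by (meson lepoll_trans subset_imp_lepoll)
qed

section \<open>The graph of the action and its orientations\<close>

context profinite_system
begin

text \<open>Equality means a common value at each of countably many coordinates, and there are
  countably many candidate values.\<close>

lemma sets_eq_points: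
  assumes "f \<in> measurable N X" "g \<in> measurable N X"
  shows "{p \<in> space N. f p = g p} \<in> sets N"
proof -
  have c: "(\<lambda>p. h p m) \<in> measurable N (count_space UNIV)" if "h \<in> measurable N X" for h m
    by (rule measurable_compose[OF that measurable_component_singleton]) simp
  have "{p \<in> space N. f p m = k \<and> g p m = k} \<in> sets N" for m k
    using c[OF assms(1), of m] c[OF assms(2), of m]
    by (intro sets.sets_Collect_conj) (auto simp: measurable_count_space_eq2_countable vimage_def Int_def conj_commute)
  then have "{p \<in> space N. \<forall>m. \<exists>k. f p m = k \<and> g p m = k} \<in> sets N"
    by (intro sets.sets_Collect_countable_All sets.sets_Collect_countable_Ex)
  then show ?thesis by (simp add: fun_eq_iff eq_commute)
qed

lemma sets_Y: "Y \<in> sets X"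
proof -
  have "{x \<in> space X. \<forall>m. x m \<in> S m} \<in> sets X"
  proof (rule sets.sets_Collect_countable_All)
    fix m
    show "{x \<in> space X. x m \<in> S m} \<in> sets X"
      using measurable_sets[OF measurable_component_singleton[of m UNIV "\<lambda>_. count_space UNIV"], of "S m"]
      by (simp add: vimage_def Int_def conj_commute)
  qed
  then show ?thesis by (simp add: Y_def space_PiM)
qed

lemma measurable_letter:
  "(\<lambda>p. letter (fst p) (snd p)) \<in> measurable (X \<Otimes>\<^sub>M X) cantor_measure"
  unfolding letter_def
proof (rule measurable_PiM_single'[where f = "\<lambda>j p. fst p (d j) \<noteq> snd p (d j)"])
  fix j
  have 1: "(\<lambda>p. fst p (d j)) \<in> measurable (X \<Otimes>\<^sub>M X) (count_space UNIV)"
    by (rule measurable_compose[OF measurable_fst measurable_component_singleton]) simp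
  have 2: "(\<lambda>p. snd p (d j)) \<in> measurable (X \<Otimes>\<^sub>M X) (count_space UNIV)"
    by (rule measurable_compose[OF measurable_snd measurable_component_singleton]) simp
  have 3: "(\<lambda>p. k \<noteq> snd p (d j)) \<in> measurable (X \<Otimes>\<^sub>M X) (count_space UNIV)" for k
    by (rule measurable_compose[OF 2]) simp
  have "(\<lambda>p. (\<lambda>k p. k \<noteq> snd p (d j)) (fst p (d j)) p) \<in> measurable (X \<Otimes>\<^sub>M X) (count_space UNIV)"
    by (rule measurable_compose_countable[OF 3 1])
  then show "(\<lambda>p. fst p (d j) \<noteq> snd p (d j)) \<in> measurable (X \<Otimes>\<^sub>M X) (count_space UNIV)"
    by simp
qed (simp add: space_PiM)

definition out_edges :: "(nat \<Rightarrow> bool) set \<Rightarrow> (('c \<Rightarrow> nat) \<times> ('c \<Rightarrow> nat)) set" where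
  "out_edges I = {(x, y). x \<in> Y \<and> (\<exists>b\<in>I. y = shift b x)}"

definition edges :: "(nat \<Rightarrow> bool) set \<Rightarrow> (('c \<Rightarrow> nat) \<times> ('c \<Rightarrow> nat)) set" where
  "edges I = out_edges I \<union> (out_edges I)\<inverse>"

text \<open>The existential over letters has a single possible witness, \<open>letter x y\<close>,
  so no projection occurs and the set is an intersection of preimages of Borel sets.\<close>

lemma sets_out_edges:
  assumes "I \<in> sets cantor_measure"
  shows "out_edges I \<in> sets (X \<Otimes>\<^sub>M X)"
proof -
  have "out_edges I = {p \<in> space (X \<Otimes>\<^sub>M X). snd p = shift (letter (fst p) (snd p)) (fst p)} \<inter>
      (\<lambda>p. letter (fst p) (snd p)) -` I \<inter> space (X \<Otimes>\<^sub>M X) \<inter> (fst -` Y \<inter> space (X \<Otimes>\<^sub>M X))"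
    by (auto simp: out_edges_def space_pair_measure space_PiM)
  also have "\<dots> \<in> sets (X \<Otimes>\<^sub>M X)"
    using sets_eq_points[OF measurable_snd measurable_shift_pair(1)[OF measurable_letter measurable_fst]]
      measurable_sets[OF measurable_letter assms] measurable_sets[OF measurable_fst sets_Y]
    by (metis (no_types, lifting) Int_assoc sets.Int)
  finally show ?thesis .
qed

lemma sets_edges:
  assumes "I \<in> sets cantor_measure"
  shows "edges I \<in> sets (X \<Otimes>\<^sub>M X)"
proof -
  have "(out_edges I)\<inverse> = (\<lambda>(x, y). (y, x)) -` out_edges I \<inter> space (X \<Otimes>\<^sub>M X)"
    by (auto simp: space_pair_measure space_PiM)
  also have "\<dots> \<in> sets (X \<Otimes>\<^sub>M X)"
    by (rule measurable_sets[OF measurable_pair_swap' sets_out_edges[OF assms]])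
  finally show ?thesis
    unfolding edges_def using sets_out_edges[OF assms] by (intro sets.Un)
qed

lemma edges_iff:
  "(x, y) \<in> edges I \<longleftrightarrow> x \<in> Y \<and> (\<exists>b\<in>I. y = shift b x \<or> y = inv (shift b) x)"
proof
  assume "(x, y) \<in> edges I"
  then show "x \<in> Y \<and> (\<exists>b\<in>I. y = shift b x \<or> y = inv (shift b) x)"
    unfolding edges_def out_edges_def by force
next
  assume *: "x \<in> Y \<and> (\<exists>b\<in>I. y = shift b x \<or> y = inv (shift b) x)"
  then obtain b where b: "b \<in> I" "y = shift b x \<or> y = inv (shift b) x" by blast
  from b(2) show "(x, y) \<in> edges I"
  proof
    assume "y = inv (shift b) x"
    then have "x = shift b y" "y \<in> Y" using * by auto
    then show ?thesis using b(1) unfolding edges_def out_edges_def by blast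
  qed (use b * in \<open>auto simp: edges_def out_edges_def\<close>)
qed

lemma edges_letter_act: "(x, y) \<in> edges I \<Longrightarrow> x \<in> Y \<and> (\<exists>b e. y = letter_act shift (b, e) x)"
  unfolding edges_iff by (metis letter_act.simps)

lemma sym_edges: "(x, y) \<in> edges I \<longleftrightarrow> (y, x) \<in> edges I"
  by (auto simp: edges_def)

lemma edges_irrefl: "(x, x) \<notin> edges I"
proof
  assume "(x, x) \<in> edges I"
  then obtain b e where "x \<in> Y" "x = letter_act shift (b, e) x"
    using edges_letter_act by blast
  then show False
    using free_action[of "[(b, e)]" x] by (simp add: reduced_def)
qed

text \<open>Equal neighbours carry equal letters, so the square of a generator would fix
  \<open>x\<close>. Hence forward and backward neighbours can be counted separately.\<close>

lemma shift_neq_inv_shift: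
  assumes "x \<in> Y"
  shows "shift b x \<noteq> inv (shift b') x"
proof
  assume eq: "shift b x = inv (shift b') x"
  then have "b = b'"
    using letter_shift[OF assms, of b] letter_inv_shift[OF assms, of b'] by simp
  then have "shift b (shift b x) = x" using eq by simp
  then show False
    using free_action[of "[(b, True), (b, True)]" x] assms by (simp add: reduced_def less_Suc_eq)
qed

text \<open>A cycle spells a reduced word: the walk would turn back at a cancellation.\<close>

lemma edges_acyclic:
  assumes "length xs \<ge> 3" "distinct xs"
    and "\<And>i. Suc i < length xs \<Longrightarrow> (xs ! i, xs ! Suc i) \<in> edges I" "(last xs, hd xs) \<in> edges I"
  shows False
proof -
  define l where "l = length xs"
  \<comment> \<open>Indices modulo \<open>l\<close> treat the closing edge like the others.\<close>
  define z where "z i = xs ! (i mod l)" for i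
  have l: "l \<ge> 3" using assms(1) by (simp add: l_def)
  have step: "(z i, z (Suc i)) \<in> edges I" if "i < l" for i
  proof (cases "Suc i = l")
    case True
    moreover have "xs \<noteq> []" using l by (auto simp: l_def)
    moreover have "i = length xs - 1" using True by (simp add: l_def)
    ultimately have "z (Suc i) = hd xs" "z i = last xs"
      by (simp_all add: z_def l_def hd_conv_nth last_conv_nth)
    then show ?thesis using assms(4) by simp
  next
    case False
    then show ?thesis using that assms(3) by (simp add: z_def l_def)
  qed
  with edges_letter_act have "\<forall>i. \<exists>c. i < l \<longrightarrow> z (Suc i) = letter_act shift c (z i)"
    by blast
  then obtain c where c: "\<And>i. i < l \<Longrightarrow> z (Suc i) = letter_act shift (c i) (z i)" by metis
  define w where "w = map c [0..<l]"
  have "reduced w"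
    unfolding reduced_def
  proof (intro allI impI, rule ccontr)
    fix i assume i: "Suc i < length w" "fst (w ! i) = fst (w ! Suc i)" "snd (w ! i) \<noteq> snd (w ! Suc i)"
    obtain b e where be: "c i = (b, e)" by (cases "c i")
    have il: "Suc i < l" using i(1) by (simp add: w_def)
    then have be': "c (Suc i) = (b, \<not> e)"
      using i be by (cases "c (Suc i)") (auto simp: w_def simp del: upt_Suc)
    \<comment> \<open>Cancelling letters make the walk return after two steps, which distinct
      vertices and \<open>l \<ge> 3\<close> forbid.\<close>
    have "z (Suc (Suc i)) = z i"
      using c[of i] c[of "Suc i"] il be be' by (cases e) simp_all
    moreover have "j mod l < length xs" for j
      using l unfolding l_def by (intro mod_less_divisor) linarith
    ultimately have "Suc (Suc i) mod l = i mod l"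
      using nth_eq_iff_index_eq[OF assms(2)] by (simp add: z_def)
    moreover have "Suc (Suc i) mod l \<noteq> i mod l"
      using l il by (cases "Suc (Suc i) = l") auto
    ultimately show False by simp
  qed
  moreover have "w \<noteq> []" using l by (simp add: w_def)
  moreover have "z 0 \<in> Y" using edges_letter_act[OF step[of 0]] l by simp
  moreover have "fold (letter_act shift) (map c [0..<j]) (z 0) = z j" if "j \<le> l" for j
    using that by (induction j) (simp_all add: c)
  then have "fold (letter_act shift) w (z 0) = z l" by (simp add: w_def)
  then have "fold (letter_act shift) w (z 0) = z 0" by (simp add: z_def)
  ultimately show False using free_action by blast
qed

text \<open>Summing the out-degrees along the letters: since the action preserves \<open>\<mu>\<close>, each letter
  contributes at least \<open>1\<close> on average.\<close>

lemma large_out_degree: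
  assumes "finite_measure \<nu>" and \<nu>: "sets \<nu> = sets cantor_measure"
    and R: "R \<in> sets (X \<Otimes>\<^sub>M X)"
    and cover: "AE b in \<nu>. \<forall>x\<in>Y. (x, shift b x) \<in> R \<or> (shift b x, x) \<in> R"
    and c: "c < emeasure \<nu> (space \<nu>)"
  shows "\<exists>x. c < emeasure \<nu> {b. (x, shift b x) \<in> R} + emeasure \<nu> {b. (x, inv (shift b) x) \<in> R}"
proof (rule ccontr)
  assume "\<nexists>x. c < emeasure \<nu> {b. (x, shift b x) \<in> R} + emeasure \<nu> {b. (x, inv (shift b) x) \<in> R}"
  then have le: "emeasure \<nu> {b. (x, shift b x) \<in> R} + emeasure \<nu> {b. (x, inv (shift b) x) \<in> R} \<le> c" for x
    by (simp add: not_less)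
  interpret \<nu>: finite_measure \<nu> by fact
  interpret pair_sigma_finite \<mu> \<nu> ..
  have sp: "space \<nu> = UNIV" using sets_eq_imp_space_eq[OF \<nu>] by (simp add: space_PiM)
  have sets_pair: "sets (\<mu> \<Otimes>\<^sub>M \<nu>) = sets (X \<Otimes>\<^sub>M cantor_measure)"
    by (rule sets_pair_measure_cong[OF sets_\<mu> \<nu>])
  have spp: "space (X \<Otimes>\<^sub>M cantor_measure) = UNIV" by (simp add: space_pair_measure space_PiM)
  define P where "P = {(x, b). (x, shift b x) \<in> R}"
  define Q where "Q = {(x, b). (x, inv (shift b) x) \<in> R}"
  have PQ: "P \<in> sets (\<mu> \<Otimes>\<^sub>M \<nu>)" "Q \<in> sets (\<mu> \<Otimes>\<^sub>M \<nu>)"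
  proof -
    have "(\<lambda>p. (fst p, shift (snd p) (fst p))) \<in> measurable (X \<Otimes>\<^sub>M cantor_measure) (X \<Otimes>\<^sub>M X)"
      "(\<lambda>p. (fst p, inv (shift (snd p)) (fst p))) \<in> measurable (X \<Otimes>\<^sub>M cantor_measure) (X \<Otimes>\<^sub>M X)"
      by (intro measurable_Pair measurable_fst measurable_shift_pair measurable_snd)+
    from measurable_sets[OF this(1) R] measurable_sets[OF this(2) R]
    show "P \<in> sets (\<mu> \<Otimes>\<^sub>M \<nu>)" "Q \<in> sets (\<mu> \<Otimes>\<^sub>M \<nu>)"
      unfolding sets_pair spp P_def Q_def by (simp_all add: vimage_def case_prod_beta')
  qed
  have mP: "(\<lambda>x. emeasure \<nu> (Pair x -` P)) \<in> borel_measurable \<mu>"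
    "(\<lambda>x. emeasure \<nu> (Pair x -` Q)) \<in> borel_measurable \<mu>"
    using PQ by (auto intro: \<nu>.measurable_emeasure_Pair)
  have mQ: "(\<lambda>b. emeasure \<mu> ((\<lambda>x. (x, b)) -` P)) \<in> borel_measurable \<nu>"
    "(\<lambda>b. emeasure \<mu> ((\<lambda>x. (x, b)) -` Q)) \<in> borel_measurable \<nu>"
    using PQ by (auto intro: measurable_emeasure_Pair2)
  have slice: "1 \<le> emeasure \<mu> ((\<lambda>x. (x, b)) -` P) + emeasure \<mu> ((\<lambda>x. (x, b)) -` Q)"
    if "\<forall>x\<in>Y. (x, shift b x) \<in> R \<or> (shift b x, x) \<in> R" for b
  proof -
    have sl: "(\<lambda>x. (x, b)) -` P \<in> sets \<mu>" "(\<lambda>x. (x, b)) -` Q \<in> sets \<mu>"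
      using PQ by (auto intro: sets_Pair2)
    have meas: "shift b \<in> measurable \<mu> \<mu>"
      using measurable_shift measurable_cong_sets[OF sets_\<mu> sets_\<mu>] by blast
    \<comment> \<open>By invariance, pulling this slice back along \<open>shift b\<close> keeps its
      measure and turns it into the set of \<open>x\<close> with
      \<open>(shift b x, x) \<in> R\<close>. Together with the slice of \<open>P\<close> that set
      covers \<open>Y\<close>.\<close>
    have "emeasure \<mu> ((\<lambda>x. (x, b)) -` Q) = emeasure (distr \<mu> \<mu> (shift b)) ((\<lambda>x. (x, b)) -` Q)"
      by (simp add: distr_shift)
    also have "\<dots> = emeasure \<mu> (shift b -` ((\<lambda>x. (x, b)) -` Q))"
      using emeasure_distr[OF meas sl(2)] by (simp add: space_\<mu>)
    finally have eq: "emeasure \<mu> ((\<lambda>x. (x, b)) -` Q) = emeasure \<mu> (shift b -` ((\<lambda>x. (x, b)) -` Q))" .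
    have sl': "shift b -` ((\<lambda>x. (x, b)) -` Q) \<in> sets \<mu>"
      using measurable_sets[OF meas sl(2)] by (simp add: space_\<mu>)
    have "1 = emeasure \<mu> (space \<mu>)" by (simp add: \<mu>.emeasure_space_1)
    also have "\<dots> \<le> emeasure \<mu> ((\<lambda>x. (x, b)) -` P \<union> shift b -` ((\<lambda>x. (x, b)) -` Q))"
      using AE_Y that sl sl' by (intro emeasure_mono_AE) (auto simp: P_def Q_def)
    also have "\<dots> \<le> emeasure \<mu> ((\<lambda>x. (x, b)) -` P) + emeasure \<mu> (shift b -` ((\<lambda>x. (x, b)) -` Q))"
      by (rule emeasure_subadditive[OF sl(1) sl'])
    finally show ?thesis using eq by simp
  qed
  have "emeasure \<nu> (space \<nu>) = (\<integral>\<^sup>+b. 1 \<partial>\<nu>)" by simp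
  also have "\<dots> \<le> (\<integral>\<^sup>+b. emeasure \<mu> ((\<lambda>x. (x, b)) -` P) + emeasure \<mu> ((\<lambda>x. (x, b)) -` Q) \<partial>\<nu>)"
    using cover by (intro nn_integral_mono_AE) (auto elim!: eventually_mono intro: slice)
  \<comment> \<open>Tonelli: the product measure is computed by slices over letters here and by
    slices over points in the next line.\<close>
  also have "\<dots> = emeasure (\<mu> \<Otimes>\<^sub>M \<nu>) P + emeasure (\<mu> \<Otimes>\<^sub>M \<nu>) Q"
    using PQ mQ by (simp add: nn_integral_add emeasure_pair_measure_alt2)
  also have "\<dots> = (\<integral>\<^sup>+x. emeasure \<nu> (Pair x -` P) + emeasure \<nu> (Pair x -` Q) \<partial>\<mu>)"
    using PQ mP by (simp add: nn_integral_add \<nu>.emeasure_pair_measure_alt)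
  also have "\<dots> \<le> (\<integral>\<^sup>+x. c \<partial>\<mu>)"
    using le by (intro nn_integral_mono) (simp add: P_def Q_def vimage_def)
  also have "\<dots> = c" by (simp add: \<mu>.emeasure_space_1)
  finally show False using c by simp
qed

end

section \<open>Cardinal bounds for out-degrees of Borel orientations\<close>

lemma lepoll_iff_card_of: "A \<lesssim> B \<longleftrightarrow> |A| \<le>o |B|"
  by (simp add: lepoll_def card_of_ordLeq)

lemma countable_imp_sets_cantor_measure:
  assumes "countable I"
  shows "I \<in> sets cantor_measure"
proof (rule sets.countable[OF _ assms])
  fix b :: "nat \<Rightarrow> bool"
  have "{b} = (\<Pi>\<^sub>E j\<in>UNIV. {b j})" by (auto simp: PiE_iff)
  also have "(\<Pi>\<^sub>E j\<in>UNIV. {b j}) \<in> sets cantor_measure"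
    by (rule sets_PiM_I_countable) simp_all
  finally show "{b} \<in> sets cantor_measure" .
qed

context profinite_system
begin

text \<open>Borel orientations on the product space, before transport, with edges as ordered
  pairs.\<close>

definition orients :: "(nat \<Rightarrow> bool) set \<Rightarrow> (('c \<Rightarrow> nat) \<times> ('c \<Rightarrow> nat)) set \<Rightarrow> bool" where
  "orients I R \<longleftrightarrow> R \<in> sets (X \<Otimes>\<^sub>M X) \<and> R \<subseteq> edges I \<and> edges I \<subseteq> R \<union> R\<inverse>"

lemma orients_cover:
  assumes "orients I R" "b \<in> I" "x \<in> Y"
  shows "(x, shift b x) \<in> R \<or> (shift b x, x) \<in> R"
proof -
  have "(x, shift b x) \<in> edges I" using assms by (auto simp: edges_iff)
  then show ?thesis using assms(1) unfolding orients_def by blast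
qed

text \<open>At a point of \<open>Y\<close>, distinct letters or directions lead to distinct
  neighbours, so the size of the sets of outgoing letters bounds the out-degree from below.\<close>

lemma lepoll_out_neighbours:
  assumes "orients I R"
  shows "{b. (x, shift b x) \<in> R} <+> {b. (x, inv (shift b) x) \<in> R} \<lesssim> {y. (x, y) \<in> R}"
proof (cases "x \<in> Y")
  case True
  define g where "g = case_sum (\<lambda>b. shift b x) (\<lambda>b. inv (shift b) x)"
  have "inj g"
  proof (rule injI)
    fix u v assume eq: "g u = g v"
    show "u = v"
    proof (cases u; cases v)
      fix b b' assume "u = Inl b" "v = Inl b'"
      moreover from this have "shift b x = shift b' x" using eq by (simp add: g_def)
      ultimately show ?thesis using letter_shift[OF True] by metis
    next
      fix b b' assume "u = Inr b" "v = Inr b'"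
      moreover from this have "inv (shift b) x = inv (shift b') x" using eq by (simp add: g_def)
      ultimately show ?thesis using letter_inv_shift[OF True] by metis
    next
      fix b b' assume "u = Inl b" "v = Inr b'"
      then show ?thesis using eq shift_neq_inv_shift[OF True, of b b'] by (simp add: g_def)
    next
      fix b b' assume "u = Inr b" "v = Inl b'"
      then show ?thesis using eq shift_neq_inv_shift[OF True, of b' b] by (simp add: g_def)
    qed
  qed
  then have "inj_on g ({b. (x, shift b x) \<in> R} <+> {b. (x, inv (shift b) x) \<in> R})"
    by (rule inj_on_subset) simp
  moreover have "g ` ({b. (x, shift b x) \<in> R} <+> {b. (x, inv (shift b) x) \<in> R}) \<subseteq> {y. (x, y) \<in> R}"
    by (auto simp: g_def)
  ultimately show ?thesis unfolding lepoll_def by blast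
next
  case False
  then have "(x, y) \<notin> R" for y
    using assms unfolding orients_def edges_iff[abs_def] by (meson edges_iff subsetD)
  then show ?thesis by simp
qed

text \<open>The averaging argument wants a finite measure, so counting measure is placed on a finite
  \<open>J\<close> even when \<open>I\<close> is infinite.\<close>

lemma finite_lepoll_out_neighbours:
  assumes "orients I R" "finite J" "J \<subseteq> I"
  shows "\<exists>x. J \<lesssim> {y. (x, y) \<in> R}"
proof (cases "J = {}")
  case False
  define \<nu> :: "(nat \<Rightarrow> bool) measure" where "\<nu> = distr (count_space J) cantor_measure (\<lambda>b. b)"
  have id: "(\<lambda>b. b) \<in> measurable (count_space J) cantor_measure"
    by (simp add: space_PiM)
  have em: "emeasure \<nu> A = of_nat (card (A \<inter> J))" if "A \<in> sets cantor_measure" for A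
    unfolding \<nu>_def using that assms(2)
    by (simp add: emeasure_distr[OF id] emeasure_count_space_finite)
  \<comment> \<open>Since \<open>emeasure\<close> is \<open>0\<close> off the \<sigma>-algebra, this
    upper bound applies to the sets of outgoing letters without a measurability proof.\<close>
  have em_le: "emeasure \<nu> A \<le> of_nat (card (A \<inter> J))" for A
  proof (cases "A \<in> sets cantor_measure")
    case False
    then have "emeasure \<nu> A = 0" by (intro emeasure_notin_sets) (simp add: \<nu>_def)
    then show ?thesis by simp
  qed (simp add: em)
  have sp: "space \<nu> = UNIV" by (simp add: \<nu>_def space_PiM)
  have "UNIV \<in> sets cantor_measure"
    using sets.top[of cantor_measure] by (simp add: space_PiM)
  then have total: "emeasure \<nu> (space \<nu>) = of_nat (card J)" by (simp add: em sp)
  have fin: "finite_measure \<nu>" by (rule finite_measureI) (simp add: total of_nat_less_top less_imp_neq)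
  have cover: "AE b in \<nu>. \<forall>x\<in>Y. (x, shift b x) \<in> R \<or> (shift b x, x) \<in> R"
  proof (rule AE_I)
    show "emeasure \<nu> (- J) = 0" using em_le[of "- J"] by simp
    have "J \<in> sets cantor_measure"
      using assms(2) by (intro countable_imp_sets_cantor_measure countable_finite)
    then show "- J \<in> sets \<nu>" using sets.compl_sets[of J cantor_measure]
      by (simp add: \<nu>_def space_PiM Compl_eq_Diff_UNIV)
    show "{b \<in> space \<nu>. \<not> (\<forall>x\<in>Y. (x, shift b x) \<in> R \<or> (shift b x, x) \<in> R)} \<subseteq> - J"
      using orients_cover[OF assms(1)] assms(3) by blast
  qed
  have "sets \<nu> = sets cantor_measure" by (simp add: \<nu>_def)
  \<comment> \<open>The averaging lemma wants a strict bound; for integers, exceeding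
    \<open>card J - 1\<close> is reaching \<open>card J\<close>.\<close>
  have "(of_nat (card J - 1) :: ennreal) < emeasure \<nu> (space \<nu>)"
    using False assms(2) by (simp add: total card_gt_0_iff)
  then obtain x where "(of_nat (card J - 1) :: ennreal) <
      emeasure \<nu> {b. (x, shift b x) \<in> R} + emeasure \<nu> {b. (x, inv (shift b) x) \<in> R}"
    using large_out_degree[OF fin \<open>sets \<nu> = sets cantor_measure\<close> _ cover] assms(1)
    unfolding orients_def by blast
  also have "\<dots> \<le> of_nat (card ({b. (x, shift b x) \<in> R} \<inter> J)) +
      of_nat (card ({b. (x, inv (shift b) x) \<in> R} \<inter> J))"
    by (intro add_mono em_le)
  finally have "(of_nat (card J - 1) :: ennreal) <
      of_nat (card ({b. (x, shift b x) \<in> R} \<inter> J) + card ({b. (x, inv (shift b) x) \<in> R} \<inter> J))"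
    by simp
  then have "card J - 1 < card ({b. (x, shift b x) \<in> R} \<inter> J) + card ({b. (x, inv (shift b) x) \<in> R} \<inter> J)"
    by (meson not_less of_nat_mono)
  then have "J \<lesssim> ({b. (x, shift b x) \<in> R} \<inter> J) <+> ({b. (x, inv (shift b) x) \<in> R} \<inter> J)"
    using assms(2) by (simp add: lepoll_iff_card_le card_Plus)
  also have "\<dots> \<lesssim> {b. (x, shift b x) \<in> R} <+> {b. (x, inv (shift b) x) \<in> R}"
    by (rule subset_imp_lepoll) auto
  also have "\<dots> \<lesssim> {y. (x, y) \<in> R}" by (rule lepoll_out_neighbours[OF assms(1)])
  finally show ?thesis by (intro exI[of _ x])
qed simp

lemma continuum_lepoll_out_neighbours:
  assumes "orients UNIV R"
  shows "\<exists>x. (UNIV :: real set) \<lesssim> {y. (x, y) \<in> R}"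
proof -
  \<comment> \<open>The Dedekind cut of \<open>t\<close>: the rationals above \<open>t\<close>,
    along an enumeration of the rationals. Density makes it injective.\<close>
  define \<psi> :: "real \<Rightarrow> nat \<Rightarrow> bool" where "\<psi> t = (\<lambda>j. t < of_rat (from_nat j))" for t
  have "inj \<psi>"
  proof (rule linorder_injI)
    fix s t :: real assume "s < t"
    then obtain r where "s < of_rat r" "of_rat r < t" using of_rat_dense by blast
    then show "\<psi> s \<noteq> \<psi> t"
      unfolding \<psi>_def fun_eq_iff by (metis from_nat_to_nat less_asym)
  qed
  define L where "L = restrict_space lborel {0..1::real}"
  have \<psi>: "\<psi> \<in> measurable L cantor_measure"
    unfolding \<psi>_def
  proof (rule measurable_PiM_single'[where f = "\<lambda>j t. t < of_rat (from_nat j)"])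
    show "(\<lambda>t. t < of_rat (from_nat j)) \<in> measurable L (count_space UNIV)" for j
      unfolding L_def by (rule measurable_restrict_space1) measurable
  qed simp
  define \<nu> where "\<nu> = distr L cantor_measure \<psi>"
  have fin: "finite_measure \<nu>"
    unfolding \<nu>_def
    by (rule finite_measure.finite_measure_distr[OF _ \<psi>], rule finite_measureI)
      (simp add: L_def emeasure_restrict_space space_restrict_space)
  have "emeasure \<nu> (space \<nu>) = emeasure L (space L)"
    unfolding \<nu>_def using emeasure_distr[OF \<psi> sets.top] by (simp add: space_PiM)
  also have "\<dots> = 1"
    by (simp add: L_def emeasure_restrict_space space_restrict_space)
  finally have pos: "0 < emeasure \<nu> (space \<nu>)" by simp
  have cover: "AE b in \<nu>. \<forall>x\<in>Y. (x, shift b x) \<in> R \<or> (shift b x, x) \<in> R"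
    using orients_cover[OF assms] by simp
  \<comment> \<open>The preimage under \<open>\<psi>\<close> has positive Lebesgue measure, hence
    size continuum, and \<open>\<psi>\<close> embeds it into \<open>A\<close>.\<close>
  have big: "(UNIV :: real set) \<lesssim> A" if "emeasure \<nu> A \<noteq> 0" for A
  proof -
    have A: "A \<in> sets cantor_measure"
      using that emeasure_notin_sets[of A \<nu>] by (auto simp: \<nu>_def)
    define B where "B = \<psi> -` A \<inter> space L"
    have BL: "B \<in> sets L" unfolding B_def by (rule measurable_sets[OF \<psi> A])
    then have B: "B \<in> sets borel" "B \<subseteq> {0..1}"
      by (auto simp: L_def sets_restrict_space)
    have "emeasure \<nu> A = emeasure L B"
      unfolding \<nu>_def B_def by (rule emeasure_distr[OF \<psi> A])
    also have "\<dots> = emeasure lborel B"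
      unfolding L_def using B by (subst emeasure_restrict_space) auto
    finally have "(UNIV :: real set) \<lesssim> B"
      using that positive_measure_imp_continuum[OF B] by simp
    also have "B \<lesssim> A"
      unfolding lepoll_def
      by (rule exI[of _ \<psi>]) (use \<open>inj \<psi>\<close> in \<open>auto simp: B_def intro: inj_on_subset\<close>)
    finally show ?thesis .
  qed
  have "sets \<nu> = sets cantor_measure" by (simp add: \<nu>_def)
  moreover have "R \<in> sets (X \<Otimes>\<^sub>M X)" using assms unfolding orients_def by blast
  ultimately obtain x where "0 < emeasure \<nu> {b. (x, shift b x) \<in> R} + emeasure \<nu> {b. (x, inv (shift b) x) \<in> R}"
    using large_out_degree[OF fin _ _ cover pos] by blast
  then have "emeasure \<nu> {b. (x, shift b x) \<in> R} \<noteq> 0 \<or> emeasure \<nu> {b. (x, inv (shift b) x) \<in> R} \<noteq> 0"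
    by auto
  then have "(UNIV :: real set) \<lesssim> {b. (x, shift b x) \<in> R} <+> {b. (x, inv (shift b) x) \<in> R}"
  proof
    assume "emeasure \<nu> {b. (x, shift b x) \<in> R} \<noteq> 0"
    from big[OF this] show ?thesis
      by (rule lepoll_trans) (auto simp: lepoll_def intro!: exI[of _ Inl])
  next
    assume "emeasure \<nu> {b. (x, inv (shift b) x) \<in> R} \<noteq> 0"
    from big[OF this] show ?thesis
      by (rule lepoll_trans) (auto simp: lepoll_def intro!: exI[of _ Inr])
  qed
  also have "\<dots> \<lesssim> {y. (x, y) \<in> R}" by (rule lepoll_out_neighbours[OF assms])
  finally show ?thesis by (intro exI[of _ x])
qed

lemma orients_out_edges:
  assumes "I \<in> sets cantor_measure"
  shows "orients I (out_edges I)"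
  unfolding orients_def using sets_out_edges[OF assms] by (auto simp: edges_def)

lemma out_edges_lepoll: "{y. (x, y) \<in> out_edges I} \<lesssim> I"
proof -
  have "{y. (x, y) \<in> out_edges I} \<subseteq> (\<lambda>b. shift b x) ` I" by (auto simp: out_edges_def)
  then show ?thesis by (meson image_lepoll lepoll_trans subset_imp_lepoll)
qed

lemma countable_edges:
  assumes "countable I"
  shows "countable {y. (x, y) \<in> edges I}"
proof -
  have "{y. (x, y) \<in> edges I} \<subseteq> (\<lambda>b. shift b x) ` I \<union> (\<lambda>b. inv (shift b) x) ` I"
    by (auto simp: edges_iff)
  then show ?thesis using assms by (meson countable_Un countable_image countable_subset)
qed

end

section \<open>Transport to the real line\<close>

lemma completely_metrizable_euclidean_nat_fun:
  "completely_metrizable_space (euclidean :: ('c::countable \<Rightarrow> nat) topology)"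
proof -
  have "(euclidean :: nat topology) = discrete_topology UNIV"
    unfolding topology_eq open_openin[symmetric] by (simp add: Topological_Spaces.open_discrete)
  then show ?thesis
    unfolding euclidean_product_topology[symmetric] completely_metrizable_space_product_topology
    by (simp add: completely_metrizable_space_discrete_topology)
qed

lemma separable_space_euclidean:
  "separable_space (euclidean :: 'a::second_countable_topology topology)"
proof -
  obtain D :: "'a set" where D: "countable D" "\<And>U. open U \<Longrightarrow> U \<noteq> {} \<Longrightarrow> \<exists>d\<in>D. d \<in> U"
    using countable_dense_exists by blast
  have "- closure D = {}"
  proof (rule ccontr)
    assume "- closure D \<noteq> {}"
    from D(2)[OF open_Compl[OF closed_closure] this] show False using closure_subset by blast
  qed
  then show ?thesis
    using D(1) by (auto simp: separable_space_def euclidean_closure_of)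
qed

lemma measurable_inv_embed_measure:
  assumes "inj h"
  shows "inv h \<in> measurable (embed_measure N h) N"
  by (rule measurable_embed_measure1) (simp add: assms)

text \<open>The injection \<open>h\<close> is arbitrary, so \<open>range h\<close> receives a copy
  of the product topology along \<open>inv h\<close>, not the subspace topology of its
  target.\<close>

lemma standard_borel_embed_measure:
  fixes h :: "('c::countable \<Rightarrow> nat) \<Rightarrow> 'b"
  assumes "inj h"
  shows "standard_borel (embed_measure (Pi\<^sub>M UNIV (\<lambda>_. count_space UNIV)) h)"
proof -
  let ?X = "Pi\<^sub>M UNIV (\<lambda>_. count_space UNIV) :: ('c \<Rightarrow> nat) measure"
  define T where "T = pullback_topology (range h) (inv h) euclidean"
  have top: "topspace T = range h" by (simp add: T_def topspace_pullback_topology)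
  have img: "inv h -` A \<inter> range h = h ` A" for A using assms by auto
  have "homeomorphic_maps euclidean T h (inv h)"
    unfolding homeomorphic_maps_def
  proof (intro conjI ballI)
    show "continuous_map euclidean T h"
      unfolding T_def by (rule continuous_map_pullback') (auto simp: assms o_def)
    show "continuous_map T euclidean (inv h)"
      unfolding T_def using continuous_map_pullback[of euclidean euclidean id "range h" "inv h"]
      by (simp add: o_def)
  qed (auto simp: top assms)
  then have hom: "(euclidean :: ('c \<Rightarrow> nat) topology) homeomorphic_space T" unfolding homeomorphic_space_def by blast
  have "sets ?X = sigma_sets UNIV {U. open U}"
  proof -
    have "sets ?X = sets (Pi\<^sub>M UNIV (\<lambda>_::'c. borel :: nat measure))"
      by (rule sets_PiM_cong) (simp_all add: sets_borel_eq_count_space)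
    also have "\<dots> = sets borel" by (rule sets_PiM_equal_borel)
    finally show ?thesis by (simp add: borel_def)
  qed
  then have "sets (embed_measure ?X h) = {inv h -` A \<inter> range h |A. A \<in> sigma_sets UNIV {U. open U}}"
    unfolding sets_embed_measure[OF assms] img by simp
  also have "\<dots> = sigma_sets (range h) {inv h -` A \<inter> range h |A. A \<in> {U. open U}}"
    by (rule sigma_sets_vimage_commute) simp
  also have "{inv h -` A \<inter> range h |A. A \<in> {U. open U}} = {U. openin T U}"
    by (auto simp: T_def openin_pullback_topology)
  finally have "sets (embed_measure ?X h) = sigma_sets (topspace T) {U. openin T U}"
    by (simp add: top)
  moreover have "topspace T = space (embed_measure ?X h)"
    by (simp add: top space_embed_measure space_PiM)
  moreover have "completely_metrizable_space T"
    using homeomorphic_completely_metrizable_space[OF hom] completely_metrizable_euclidean_nat_fun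
    by blast
  moreover have "separable_space T"
    using homeomorphic_separable_space[OF hom] separable_space_euclidean by blast
  ultimately show ?thesis unfolding standard_borel_def by blast
qed

text \<open>The image is a preimage under the measurable map \<open>inv h\<close> in both
  coordinates.\<close>

lemma sets_map_prod_image:
  assumes "inj h" "space N = UNIV" "E \<in> sets (N \<Otimes>\<^sub>M N)"
  shows "map_prod h h ` E \<in> sets (embed_measure N h \<Otimes>\<^sub>M embed_measure N h)"
proof -
  let ?M = "embed_measure N h"
  have inv: "inv h \<in> measurable ?M N" by (rule measurable_inv_embed_measure[OF assms(1)])
  have "(\<lambda>p. (inv h (fst p), inv h (snd p))) \<in> measurable (?M \<Otimes>\<^sub>M ?M) (N \<Otimes>\<^sub>M N)"
    by (intro measurable_Pair measurable_compose[OF measurable_fst inv]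
        measurable_compose[OF measurable_snd inv])
  from measurable_sets[OF this assms(3)]
  have "(\<lambda>p. (inv h (fst p), inv h (snd p))) -` E \<inter> space (?M \<Otimes>\<^sub>M ?M) \<in> sets (?M \<Otimes>\<^sub>M ?M)" .
  also have "(\<lambda>p. (inv h (fst p), inv h (snd p))) -` E \<inter> space (?M \<Otimes>\<^sub>M ?M) = map_prod h h ` E"
    using assms(1,2) by (force simp: space_pair_measure space_embed_measure)
  finally show ?thesis .
qed

lemma sets_vimage_embed_measure:
  assumes "inj h" "R \<in> sets (embed_measure N h \<Otimes>\<^sub>M embed_measure N h)" "space N = UNIV"
  shows "{(x, y). (h x, h y) \<in> R} \<in> sets (N \<Otimes>\<^sub>M N)"
proof -
  have h: "h \<in> measurable N (embed_measure N h)" by (rule measurable_embed_measure2[OF assms(1)])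
  have "(\<lambda>p. (h (fst p), h (snd p))) \<in> measurable (N \<Otimes>\<^sub>M N) (embed_measure N h \<Otimes>\<^sub>M embed_measure N h)"
    by (intro measurable_Pair measurable_compose[OF measurable_fst h]
        measurable_compose[OF measurable_snd h])
  from measurable_sets[OF this assms(2)] show ?thesis
    using assms(3) by (simp add: space_pair_measure vimage_def case_prod_beta')
qed

text \<open>With this the value \<aleph>0 may be approached along different vertices; no single
  vertex of infinite out-degree has to be found. A cardinal above all finite subsets of an infinite
  set is infinite, hence above every countable set.\<close>

lemma ordLeq_of_finite_subsets:
  assumes "countable I" "Card_order \<kappa>" "\<And>J. finite J \<Longrightarrow> J \<subseteq> I \<Longrightarrow> |J| \<le>o \<kappa>"
  shows "|I| \<le>o \<kappa>"
proof (cases "finite I")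
  case False
  have F: "|Field \<kappa>| =o \<kappa>" by (rule card_of_Field_ordIso[OF assms(2)])
  have fin: "J \<lesssim> Field \<kappa>" if "finite J" "J \<subseteq> I" for J
    unfolding lepoll_iff_card_of
    by (rule ordLeq_ordIso_trans[OF assms(3)[OF that] ordIso_symmetric[OF F]])
  have "infinite (Field \<kappa>)"
  proof
    assume fF: "finite (Field \<kappa>)"
    obtain J where J: "finite J" "card J = Suc (card (Field \<kappa>))" "J \<subseteq> I"
      using infinite_arbitrarily_large[OF False] by blast
    then show False using fin[OF J(1,3)] fF by (simp add: lepoll_iff_card_le)
  qed
  then have "(UNIV :: nat set) \<lesssim> Field \<kappa>" by (simp add: infinite_le_lepoll)
  moreover have "I \<lesssim> (UNIV :: nat set)"
    using assms(1) unfolding countable_def lepoll_def by auto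
  ultimately have "I \<lesssim> Field \<kappa>" by (meson lepoll_trans)
  then show ?thesis
    unfolding lepoll_iff_card_of using F by (rule ordLeq_ordIso_trans)
qed (use assms(3) in blast)

section \<open>The graph on the reals and its orientation number\<close>

context profinite_system
begin

definition real_graph :: "(('c \<Rightarrow> nat) \<Rightarrow> real) \<Rightarrow> (nat \<Rightarrow> bool) set \<Rightarrow> real set set" where
  "real_graph h I = {{h x, h y} |x y. (x, y) \<in> edges I}"

lemma real_graph_iff:
  "{u, v} \<in> real_graph h I \<longleftrightarrow> (\<exists>x y. u = h x \<and> v = h y \<and> (x, y) \<in> edges I)"
  unfolding real_graph_def using sym_edges by (auto simp: doubleton_eq_iff) blast+

context
  fixes h :: "('c \<Rightarrow> nat) \<Rightarrow> real"
  assumes inj: "inj h"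
begin

lemma real_graph_iff': "{h x, h y} \<in> real_graph h I \<longleftrightarrow> (x, y) \<in> edges I"
  unfolding real_graph_iff using inj by (auto dest: injD)

lemma borel_graph_real_graph:
  assumes "I \<in> sets cantor_measure"
  shows "borel_graph (embed_measure X h) (real_graph h I)"
proof -
  have "{(u, v). {u, v} \<in> real_graph h I} = map_prod h h ` edges I"
    unfolding real_graph_iff by force
  moreover have "map_prod h h ` edges I \<in> sets (embed_measure X h \<Otimes>\<^sub>M embed_measure X h)"
    by (rule sets_map_prod_image[OF inj _ sets_edges[OF assms]]) (simp add: space_PiM)
  moreover have "card {h x, h y} = 2" if "(x, y) \<in> edges I" for x y
    using that edges_irrefl inj by (metis card_2_iff injD)
  ultimately show ?thesis
    by (auto simp: borel_graph_def real_graph_def space_embed_measure space_PiM)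
qed

lemma acyclic_real_graph: "acyclic_graph (real_graph h I)"
  unfolding acyclic_graph_def
proof
  assume "\<exists>xs. is_cycle (real_graph h I) xs"
  then obtain xs where xs: "length xs \<ge> 3" "distinct xs"
      "\<And>i. Suc i < length xs \<Longrightarrow> {xs ! i, xs ! Suc i} \<in> real_graph h I"
      "{last xs, hd xs} \<in> real_graph h I"
    unfolding is_cycle_def by blast
  have e: "(inv h u, inv h v) \<in> edges I" if "{u, v} \<in> real_graph h I" for u v
    using that inj unfolding real_graph_iff by auto
  \<comment> \<open>\<open>inv h\<close> is known to be injective on \<open>range h\<close> only; a
    vertex of a cycle lies on an edge and so belongs to it.\<close>
  have "xs ! i \<in> range h" if "i < length xs" for i
  proof (cases "Suc i < length xs")
    case True
    then show ?thesis using xs(3)[OF True] unfolding real_graph_iff by blast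
  next
    case False
    then have "i = length xs - 1" using that by simp
    then have "xs ! i = last xs" using that by (metis last_conv_nth list.size(3) not_less_zero)
    then show ?thesis using xs(4) unfolding real_graph_iff by auto
  qed
  then have "set xs \<subseteq> range h" by (auto simp: in_set_conv_nth)
  then have "distinct (map (inv h) xs)"
    using xs(2) inj_on_inv_into[of "set xs" h UNIV] by (simp add: distinct_map)
  moreover have "xs \<noteq> []" using xs(1) by auto
  ultimately show False
    using edges_acyclic[of "map (inv h) xs" I] xs(1,3,4) e by (simp add: last_map hd_map)
qed

lemma locally_countable_real_graph:
  assumes "countable I"
  shows "locally_countable (embed_measure X h) (real_graph h I)"
  unfolding locally_countable_def
proof
  fix u assume "u \<in> space (embed_measure X h)"
  then obtain x where u: "u = h x" by (auto simp: space_embed_measure)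
  have "{v. {u, v} \<in> real_graph h I} \<subseteq> h ` {y. (x, y) \<in> edges I}"
    unfolding u real_graph_iff using inj by (auto dest: injD)
  then show "countable {v. {u, v} \<in> real_graph h I}"
    using countable_edges[OF assms] by (meson countable_image countable_subset)
qed

text \<open>The hypothesis \<open>low\<close> is used twice: for \<open>R\<close> itself it makes
  \<open>n\<close> the least upper bound of the out-degrees, and for the pullback of any other Borel
  orientation it gives minimality.\<close>

lemma is_borel_orientation_number_real_graph:
  assumes "Card_order n"
    and up: "orients I R" "\<And>x. |{y. (x, y) \<in> R}| \<le>o n"
    and low: "\<And>R (\<kappa> :: real rel). orients I R \<Longrightarrow> Card_order \<kappa> \<Longrightarrow>
      (\<And>x. |{y. (x, y) \<in> R}| \<le>o \<kappa>) \<Longrightarrow> n \<le>o \<kappa>"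
  shows "is_borel_orientation_number (embed_measure X h) (real_graph h I) n"
proof -
  let ?M = "embed_measure X h"
  have sp: "space X = UNIV" by (simp add: space_PiM)
  have pull: "n \<le>o \<kappa>" if "borel_orientation ?M (real_graph h I) R" "is_card_sup \<kappa> (out_degree R ` space ?M)"
    for R and \<kappa> :: "real rel"
  proof (rule low)
    let ?R = "{(x, y). (h x, h y) \<in> R}"
    have R: "R \<in> sets (?M \<Otimes>\<^sub>M ?M)" "\<And>u v. {u, v} \<in> real_graph h I \<longleftrightarrow> (u, v) \<in> R \<or> (v, u) \<in> R"
      using that(1) by (auto simp: borel_orientation_def orientation_def)
    have "?R \<in> sets (X \<Otimes>\<^sub>M X)" by (rule sets_vimage_embed_measure[OF inj R(1) sp])
    moreover have "(x, y) \<in> edges I \<longleftrightarrow> (h x, h y) \<in> R \<or> (h y, h x) \<in> R" for x y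
      using R(2) real_graph_iff' by blast
    ultimately show "orients I ?R" unfolding orients_def by auto
    show "Card_order \<kappa>" using that(2) by (simp add: is_card_sup_def)
    fix x
    have "{y. (x, y) \<in> ?R} \<lesssim> {v. (h x, v) \<in> R}"
      unfolding lepoll_def by (rule exI[of _ h]) (use inj in \<open>auto intro: inj_on_subset\<close>)
    then have "|{y. (x, y) \<in> ?R}| \<le>o out_degree R (h x)"
      by (simp add: out_degree_def lepoll_iff_card_of)
    moreover have "out_degree R (h x) \<le>o \<kappa>"
      using that(2) by (simp add: is_card_sup_def space_embed_measure sp)
    ultimately show "|{y. (x, y) \<in> ?R}| \<le>o \<kappa>" by (rule ordLeq_transitive)
  qed
  define R' where "R' = map_prod h h ` R"
  have R'_iff: "(h x, h y) \<in> R' \<longleftrightarrow> (x, y) \<in> R" for x y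
    using inj by (auto simp: R'_def dest: injD)
  have "R' \<in> sets (?M \<Otimes>\<^sub>M ?M)"
    unfolding R'_def using up(1) sp by (intro sets_map_prod_image inj) (auto simp: orients_def)
  moreover have "{u, v} \<in> real_graph h I \<longleftrightarrow> (u, v) \<in> R' \<or> (v, u) \<in> R'" for u v
  proof
    assume "{u, v} \<in> real_graph h I"
    then obtain x y where "u = h x" "v = h y" "(x, y) \<in> edges I" unfolding real_graph_iff by blast
    then show "(u, v) \<in> R' \<or> (v, u) \<in> R'"
      using up(1) R'_iff unfolding orients_def by blast
  next
    assume *: "(u, v) \<in> R' \<or> (v, u) \<in> R'"
    have "{a, b} \<in> real_graph h I" if "(a, b) \<in> R'" for a b
      using that up(1) unfolding real_graph_iff R'_def orients_def by auto
    then show "{u, v} \<in> real_graph h I" using * by (metis insert_commute)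
  qed
  ultimately have "borel_orientation ?M (real_graph h I) R'"
    unfolding borel_orientation_def orientation_def by blast
  moreover have "is_card_sup n (out_degree R' ` space ?M)"
  proof -
    have "{v. (h x, v) \<in> R'} = h ` {y. (x, y) \<in> R}" for x
      using inj by (auto simp: R'_def dest: injD)
    moreover have "h ` A \<approx> A" for A
      using inj by (intro inj_on_image_eqpoll_self) (auto intro: inj_on_subset)
    ultimately have eq: "out_degree R' (h x) =o |{y. (x, y) \<in> R}|" for x
      by (simp add: out_degree_def eqpoll_iff_card_of_ordIso)
    have "n \<le>o \<kappa>" if "Card_order \<kappa>" "\<forall>r\<in>out_degree R' ` space ?M. r \<le>o \<kappa>" for \<kappa> :: "real rel"
    proof (rule low[OF up(1) that(1)])
      fix x
      have "out_degree R' (h x) \<le>o \<kappa>" using that(2) by (simp add: space_embed_measure sp)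
      then show "|{y. (x, y) \<in> R}| \<le>o \<kappa>"
        by (rule ordIso_ordLeq_trans[OF ordIso_symmetric[OF eq]])
    qed
    moreover have "out_degree R' (h x) \<le>o n" for x
      by (rule ordIso_ordLeq_trans[OF eq up(2)])
    ultimately show ?thesis
      using assms(1) by (auto simp: is_card_sup_def space_embed_measure)
  qed
  ultimately show ?thesis
    unfolding is_borel_orientation_number_def using pull by blast
qed

end

end

section \<open>Choice of the generators for each cardinal\<close>

text \<open>A function is coded by its graph, a set of natural numbers under pairing.\<close>

lemma nat_fun_lepoll_real: "(UNIV :: ('c::countable \<Rightarrow> nat) set) \<lesssim> (UNIV :: real set)"
proof -
  define g where "g f = (\<lambda>c. prod_encode (to_nat c, f c)) ` UNIV" for f :: "'c \<Rightarrow> nat"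
  have "inj g"
  proof (rule injI, rule ext)
    fix f f' c assume "g f = g f'"
    then have "prod_encode (to_nat c, f c) \<in> g f'" unfolding g_def by blast
    then show "f c = f' c" unfolding g_def by auto
  qed
  then have "(UNIV :: ('c \<Rightarrow> nat) set) \<lesssim> (UNIV :: nat set set)" unfolding lepoll_def by blast
  then show ?thesis using nat_sets_eqpoll_reals by (rule lepoll_trans2)
qed

theorem mainTheorem12:
  fixes n :: "real rel"
  assumes "(\<exists>k::nat. n =o |{..<k}| ) \<or> n =o |UNIV :: nat set| \<or> n =o |UNIV :: real set|"
  shows "\<exists>(M :: real measure) G.
           standard_borel M \<and> borel_graph M G \<and> acyclic_graph G \<and>
           is_borel_orientation_number M G n \<and>
           (n \<le>o |UNIV :: nat set| \<longrightarrow> locally_countable M G)"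
proof -
  obtain S :: "nat + (bool list \<times> bool) list \<Rightarrow> nat set" and \<tau> d where "profinite_system S \<tau> d"
    using profinite_system_exists by blast
  then interpret profinite_system S \<tau> d .
  obtain h :: "(nat + (bool list \<times> bool) list \<Rightarrow> nat) \<Rightarrow> real" where h: "inj h"
    using nat_fun_lepoll_real unfolding lepoll_def by blast
  have goal: ?thesis
    if "I \<in> sets cantor_measure" "is_borel_orientation_number (embed_measure X h) (real_graph h I) n"
      "n \<le>o |UNIV :: nat set| \<Longrightarrow> countable I" for I
    using that standard_borel_embed_measure[OF h] borel_graph_real_graph[OF h] acyclic_real_graph[OF h]
      locally_countable_real_graph[OF h]
    by (intro exI[of _ "embed_measure X h"] exI[of _ "real_graph h I"]) blast
  \<comment> \<open>Finite \<open>n\<close> and \<aleph>0 are treated together, as cardinalities of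
    subsets of \<open>nat\<close>.\<close>
  consider A :: "nat set" where "n =o |A|" | "n =o |UNIV :: real set|" using assms by blast
  then show ?thesis
  proof cases
    case (1 A)
    \<comment> \<open>Indicators of singletons: a copy of \<open>A\<close> inside Cantor
      space.\<close>
    define I where "I = (\<lambda>i j. j = i) ` A"
    have "inj (\<lambda>i j :: nat. j = i)" by (rule injI) metis
    then have "I \<approx> A"
      unfolding I_def by (intro inj_on_image_eqpoll_self) (auto intro: inj_on_subset)
    then have nI: "n =o |I|"
      unfolding eqpoll_iff_card_of_ordIso using 1 by (meson ordIso_symmetric ordIso_transitive)
    have cI: "countable I" unfolding I_def by simp
    show ?thesis
    proof (rule goal)
      show I: "I \<in> sets cantor_measure" by (rule countable_imp_sets_cantor_measure[OF cI])
      show "is_borel_orientation_number (embed_measure X h) (real_graph h I) n"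
      proof (rule is_borel_orientation_number_real_graph[OF h _ orients_out_edges[OF I]])
        show "Card_order n" by (rule Card_order_ordIso[OF card_of_Card_order 1])
        show "|{y. (x, y) \<in> out_edges I}| \<le>o n" for x
          using out_edges_lepoll[of x I] nI unfolding lepoll_iff_card_of
          by (meson ordIso_symmetric ordLeq_ordIso_trans)
        fix R and \<kappa> :: "real rel"
        assume R: "orients I R" and \<kappa>: "Card_order \<kappa>" "\<And>x. |{y. (x, y) \<in> R}| \<le>o \<kappa>"
        have "|J| \<le>o \<kappa>" if J: "finite J" "J \<subseteq> I" for J
          using finite_lepoll_out_neighbours[OF R J] \<kappa>(2) unfolding lepoll_iff_card_of
          by (meson ordLeq_transitive)
        then have "|I| \<le>o \<kappa>" by (rule ordLeq_of_finite_subsets[OF cI \<kappa>(1)])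
        then show "n \<le>o \<kappa>" by (rule ordIso_ordLeq_trans[OF nI])
      qed
    qed (rule cI)
  next
    case 2
    show ?thesis
    proof (rule goal)
      show I: "UNIV \<in> sets cantor_measure"
        using sets.top[of cantor_measure] by (simp add: space_PiM)
      \<comment> \<open>For the continuum the upper bound is the size of the vertex set, so every
        edge may be oriented both ways.\<close>
      have R: "orients UNIV (edges UNIV)"
        unfolding orients_def using sets_edges[OF I] by auto
      show "is_borel_orientation_number (embed_measure X h) (real_graph h UNIV) n"
      proof (rule is_borel_orientation_number_real_graph[OF h _ R])
        show "Card_order n" by (rule Card_order_ordIso[OF card_of_Card_order 2])
        fix x
        have "{y. (x, y) \<in> edges UNIV} \<lesssim> (UNIV :: real set)"
          by (meson lepoll_trans nat_fun_lepoll_real subset_UNIV subset_imp_lepoll)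
        then show "|{y. (x, y) \<in> edges UNIV}| \<le>o n"
          unfolding lepoll_iff_card_of using 2 by (meson ordIso_symmetric ordLeq_ordIso_trans)
      next
        fix R and \<kappa> :: "real rel"
        assume R: "orients UNIV R" and \<kappa>: "\<And>x. |{y. (x, y) \<in> R}| \<le>o \<kappa>"
        show "n \<le>o \<kappa>"
          using continuum_lepoll_out_neighbours[OF R] \<kappa> 2 unfolding lepoll_iff_card_of
          by (meson ordIso_ordLeq_trans ordLeq_transitive)
      qed
      assume "n \<le>o |UNIV :: nat set|"
      then have "(UNIV :: real set) \<lesssim> (UNIV :: nat set)"
        unfolding lepoll_iff_card_of using 2 by (meson ordIso_ordLeq_trans ordIso_symmetric)
      then have "countable (UNIV :: real set)" by (meson countable_lepoll countableI_type)
      then show "countable (UNIV :: (nat \<Rightarrow> bool) set)" using uncountable_UNIV_real by blast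
    qed
  qed
qed

end
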